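(* Let $3\le n_1<n_2<\dots<n_k$ be integers. (i) If the family consists of exactly one convex $n_i$-gon for each $i=1,\dots,k$, then the maximal configuration is $$\Big[\Big(2\sum_{i=1}^{k-1}n_i(k-i)\Big)_4\Big].$$ (ii) If the family consists of $m_i$ convex $n_i$-gons for each $i=1,\dots,k$ (with integers $m_i\ge1$), then the maximal configuration is $$\Big[\Big(\sum_{i=1}^{k}n_im_i(m_i-1)+2\sum_{i=1}^{k-1}n_im_i\Big(\sum_{j=i+1}^{k}m_j\Big)\Big)_4\Big].$$
   Context: A convex $n$-gon is regarded as a closed curve in $\mathbb{R}^2$ (the boundary of a convex polygon with $n$ sides). For a finite family of such curves with connected union and finitely many mutual intersection points, a node is a point lying on at least two distinct curves, and its fold is the number of connected components of $((\bigcup\text{curves})\setminus\{P\})\cap U$ for a sufficiently small neighbourhood $U$ of the node $P$. The configuration $[(n_1)_{d_1}:\dots:(n_r)_{d_r}]$ records that there are exactly $n_i$ nodes of fold $d_i$; thus $[(N)_4]$ means that there are exactly $N$ nodes, all of fold $4$. A configuration is maximal for a prescribed type of family (here: prescribed numbers of convex polygons with prescribed numbers of sides, their shapes and positions being free) if no other configuration realized by a family of the same type has a larger total number of nodes $n_1+\dots+n_r$. *)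

theory Defs
  imports "HOL-Analysis.Analysis" "HOL-Library.Multiset"
begin

text \<open>
  A polygon is a two-dimensional polytope in the plane; its sides are its edges in the
  sense of the face lattice, so that no two sides lie on a common line.
\<close>

definition convex_ngon :: "nat \<Rightarrow> (real^2) set \<Rightarrow> bool" where
  "convex_ngon n C \<longleftrightarrow>
     (\<exists>P. polytope P \<and> aff_dim P = 2 \<and> card {E. E edge_of P} = n \<and> C = frontier P)"

definition nodes :: "(real^2) set set \<Rightarrow> (real^2) set" where
  "nodes F = {p. \<exists>C\<in>F. \<exists>D\<in>F. C \<noteq> D \<and> p \<in> C \<and> p \<in> D}"

text \<open>
  The sufficiently small neighbourhoods of a node are taken to be open discs centred at it:
  the number of components is required to be the same finite number for all small radii.
  There is at most one such number, and for finite families of polygons it exists.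
\<close>

definition node_fold :: "(real^2) set set \<Rightarrow> real^2 \<Rightarrow> nat" where
  "node_fold F p = (THE d. \<forall>\<^sub>F r in at_right 0.
     finite (components ((\<Union>F - {p}) \<inter> ball p r)) \<and>
     card (components ((\<Union>F - {p}) \<inter> ball p r)) = d)"

text \<open>
  The configuration \<open>[(n\<^sub>1)\<^bsub>d\<^sub>1\<^esub> : \<dots> : (n\<^sub>r)\<^bsub>d\<^sub>r\<^esub>]\<close> is the multiset in which each fold \<open>d\<^sub>i\<close> occurs
  \<open>n\<^sub>i\<close> times. Thus \<open>[(N)\<^sub>4]\<close> is \<open>replicate_mset N 4\<close>, and the total number of nodes
  is the size of the multiset.
\<close>

definition configuration :: "(real^2) set set \<Rightarrow> nat multiset" where
  "configuration F = image_mset (node_fold F) (mset_set (nodes F))"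

text \<open>
  The families consisting of \<open>m i\<close> convex \<open>n i\<close>-gons for \<open>i = 1, \<dots>, k\<close>. Families are sets of
  curves: two coinciding members would have infinitely many common points.
\<close>

definition polygon_families ::
    "nat \<Rightarrow> (nat \<Rightarrow> nat) \<Rightarrow> (nat \<Rightarrow> nat) \<Rightarrow> (real^2) set set set" where
  "polygon_families k n m =
     {F. finite F \<and>
         (\<forall>C\<in>F. \<exists>i\<in>{1..k}. convex_ngon (n i) C) \<and>
         (\<forall>i\<in>{1..k}. card {C\<in>F. convex_ngon (n i) C} = m i) \<and>
         connected (\<Union>F) \<and> finite (nodes F)}"

definition maximal_configuration :: "(real^2) set set set \<Rightarrow> nat multiset \<Rightarrow> bool" where
  "maximal_configuration T c \<longleftrightarrow>
     c \<in> configuration ` T \<and> (\<forall>c'\<in>configuration ` T. size c' \<le> size c)"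

end

theory Submission
  imports Defs
begin

text \<open>
  Upper bound. Let \<open>C\<close> and \<open>D\<close> be convex polygons with \<open>n \<le> n'\<close> sides and only finitely many common
  points. A side of \<open>C\<close> meets the boundary curve \<open>D\<close> at most twice, for otherwise it would share a
  whole segment with it; hence \<open>card (C \<inter> D) \<le> 2 * n\<close> (\<open>card_Int_convex_ngon_le\<close>). Every node lies on
  such an intersection, so the number of nodes is at most the sum of \<open>2 * min n n'\<close> over all pairs of
  curves. Grouped by numbers of sides this sum is the number in the theorem (\<open>sum_pairs_min\<close>).

  Folds. Near any of its points a convex polygon consists of two rays, so the fold of a node is twice
  the number of curves through it (\<open>node_fold_eq\<close>). If the upper bound is attained, no node is
  counted by two pairs of curves, that is, exactly two curves pass through each node, and all folds
  are \<open>4\<close> (\<open>card_nodes_le\<close>). The maximal configuration is therefore determined as soon as one family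
  attains the bound.

  Construction. All polygons are circumscribed about the unit circle, and no two sides, of the same or
  of different polygons, have the same point of contact. At most two tangents of a circle pass through
  any point, so no three of the curves have a common point (\<open>no_three_tangents\<close>). The point of
  contact of a side of one polygon lies inside every other polygon. If the points of contact are
  distributed evenly enough, between the points of contact of any two adjacent sides of a polygon
  there is one of every other polygon with at least as many sides, whose tangent cuts off the vertex in
  between. Hence each side of the polygon with fewer sides starts outside the other polygon, passes
  through its interior and ends outside, which gives two crossings on every side
  (\<open>card_Int_grid_polygons_ge\<close>).
\<close>

section \<open>Convex polygons and their boundary curves\<close>

lemma frontier_polygon_eq_Union_edges:
  fixes P :: "'a::euclidean_space set"
  assumes "polyhedron P" and "aff_dim P = 2" and "DIM('a) = 2"
  shows "frontier P = \<Union>{E. E edge_of P}"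
proof -
  have "affine hull P = UNIV"
    using assms aff_dim_eq_full[of P] by simp
  then have "frontier P = rel_frontier P"
    by (simp add: rel_frontier_frontier)
  also have "\<dots> = \<Union>{E. E facet_of P}"
    by (rule rel_frontier_of_polyhedron[OF assms(1)])
  also have "{E. E facet_of P} = {E. E edge_of P}"
    using assms(2) by (auto simp: facet_of_def edge_of_def)
  finally show ?thesis .
qed

lemma convex_ngonE:
  assumes "convex_ngon n C"
  obtains P where "polytope P" "aff_dim P = 2" "card {E. E edge_of P} = n" "C = frontier P"
    "convex P" "compact P" "polyhedron P" "interior P \<noteq> {}" "C = \<Union>{E. E edge_of P}"
proof -
  obtain P where P: "polytope P" "aff_dim P = 2" "card {E. E edge_of P} = n" "C = frontier P"
    using assms unfolding convex_ngon_def by blast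
  have "affine hull P = UNIV"
    using P(2) aff_dim_eq_full[of P] by simp
  then have "rel_interior P = interior P"
    by (simp add: rel_interior_interior)
  then have "interior P \<noteq> {}"
    using P(1,2) rel_interior_eq_empty[of P] polytope_imp_convex[of P] by auto
  moreover have "C = \<Union>{E. E edge_of P}"
    using frontier_polygon_eq_Union_edges[of P] P polytope_imp_polyhedron by auto
  ultimately show thesis
    using that P polytope_imp_convex polytope_imp_compact polytope_imp_polyhedron by blast
qed

text \<open>A convex body is the convex hull of its boundary, so the boundary curve determines the
  polygon and in particular its number of sides.\<close>

lemma convex_ngon_unique:
  assumes "convex_ngon n C" "convex_ngon n' C"
  shows "n = n'"
proof -
  obtain P where P: "card {E. E edge_of P} = n" "C = frontier P" "convex P" "compact P"
    by (rule convex_ngonE[OF assms(1)]) (rule that; assumption)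
  obtain P' where P': "card {E. E edge_of P'} = n'" "C = frontier P'" "convex P'" "compact P'"
    by (rule convex_ngonE[OF assms(2)]) (rule that; assumption)
  have "P = convex hull C" "P' = convex hull C"
    using Krein_Milman_frontier[of P] Krein_Milman_frontier[of P'] P(2-4) P'(2-4) by simp_all
  then show ?thesis using P(1) P'(1) by simp
qed

lemma closed_convex_ngon: "convex_ngon n C \<Longrightarrow> closed C"
  by (elim convex_ngonE) simp

lemma connected_convex_ngon:
  assumes "convex_ngon n C"
  shows "connected C"
proof -
  obtain P where P: "C = frontier P" "convex P" "compact P"
    by (rule convex_ngonE[OF assms]) (rule that; assumption)
  have "connected (- P)"
    using P by (intro connected_complement_bounded_convex) (auto simp: compact_imp_bounded)
  then show ?thesis
    unfolding P(1) using convex_connected[OF P(2)] by (intro connected_frontier_simple) auto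
qed

section \<open>Intersections of two polygons\<close>

text \<open>Of three collinear points on the boundary of a convex set, the outer two span a segment
  inside that boundary: an interior point on this segment would make the middle point interior.\<close>

lemma open_segment_subset_frontier:
  fixes Q :: "'a::euclidean_space set"
  assumes "convex Q" "closed Q" "x \<in> Q" "z \<in> Q" "y \<in> frontier Q" "y \<in> open_segment x z"
  shows "open_segment x z \<subseteq> frontier Q"
proof
  fix w assume w: "w \<in> open_segment x z"
  have seg: "closed_segment x z \<subseteq> Q"
    using assms by (simp add: closed_segment_subset)
  have "w \<notin> interior Q"
  proof
    assume wi: "w \<in> interior Q"
    have "w \<noteq> y" using wi assms(5) by (auto simp: frontier_def)
    have "y \<in> closed_segment x w \<union> closed_segment w z"
      using assms(6) w by (metis Un_closed_segment open_closed_segment)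
    then have "y \<in> open_segment w x \<union> open_segment w z"
      using \<open>w \<noteq> y\<close> assms(6)
      by (auto simp: open_segment_def closed_segment_commute)
    moreover have "open_segment w x \<subseteq> interior Q" "open_segment w z \<subseteq> interior Q"
      using in_interior_closure_convex_segment[OF assms(1) wi] assms(3,4) closure_subset by blast+
    ultimately show False using assms(5) by (auto simp: frontier_def)
  qed
  then show "w \<in> frontier Q"
    using open_closed_segment[OF w] seg closure_subset[of Q] by (auto simp: frontier_def)
qed

lemma card_collinear_Int_frontier_le_2:
  fixes E Q :: "'a::euclidean_space set"
  assumes "convex E" "collinear E" "convex Q" "closed Q" "finite (E \<inter> frontier Q)"
  shows "card (E \<inter> frontier Q) \<le> 2"
proof (rule ccontr)
  assume "\<not> ?thesis"
  then have "3 \<le> card (E \<inter> frontier Q)" by simp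
  then obtain T where T: "T \<subseteq> E \<inter> frontier Q" "card T = 3"
    by (meson obtain_subset_with_card_n)
  then obtain a b c where abc: "T = {a, b, c}" "a \<noteq> b" "a \<noteq> c" "b \<noteq> c"
    by (metis card_3_iff)
  have out: "\<not> z \<in> open_segment x y" if "x \<in> T" "y \<in> T" "z \<in> T" "x \<noteq> y" for x y z
  proof
    assume z: "z \<in> open_segment x y"
    have Q: "x \<in> Q" "y \<in> Q"
      using that T frontier_subset_closed[OF assms(4)] by blast+
    have "open_segment x y \<subseteq> frontier Q"
      using open_segment_subset_frontier[OF assms(3,4) Q _ z] that T by blast
    moreover have "open_segment x y \<subseteq> E"
      using that T closed_segment_subset[of x E y] assms(1) segment_open_subset_closed[of x y] by blast
    ultimately have "finite (open_segment x y)"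
      by (intro finite_subset[OF _ assms(5)]) blast
    with that show False by simp
  qed
  have "collinear {a, b, c}"
    using T(1) abc(1) by (intro collinear_subset[OF assms(2)]) auto
  then have "a \<in> closed_segment b c \<or> b \<in> closed_segment c a \<or> c \<in> closed_segment a b"
    unfolding collinear_between_cases between_mem_segment .
  then have "a \<in> open_segment b c \<or> b \<in> open_segment c a \<or> c \<in> open_segment a b"
    using abc(2-4) unfolding open_segment_def by blast
  then show False
    using out[of b c a] out[of c a b] out[of a b c] abc by blast
qed

lemma card_Int_convex_ngon_le:
  assumes "convex_ngon n C" "convex_ngon n' D" "finite (C \<inter> D)"
  shows "card (C \<inter> D) \<le> 2 * n"
proof -
  obtain P where P: "card {E. E edge_of P} = n" "C = \<Union>{E. E edge_of P}" "polytope P"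
    by (rule convex_ngonE[OF assms(1)]) (rule that; assumption)
  obtain Q where Q: "D = frontier Q" "convex Q" "compact Q"
    by (rule convex_ngonE[OF assms(2)]) (rule that; assumption)
  have fin: "finite {E. E edge_of P}"
    by (rule finite_subset[OF _ finite_polytope_faces[OF P(3)]]) (auto simp: edge_of_def)
  have "card (C \<inter> D) = card (\<Union>E\<in>{E. E edge_of P}. E \<inter> D)"
    unfolding P(2) by (rule arg_cong[where f = card]) blast
  also have "\<dots> \<le> (\<Sum>E\<in>{E. E edge_of P}. card (E \<inter> D))"
    by (rule card_UN_le[OF fin])
  also have "\<dots> \<le> (\<Sum>E\<in>{E. E edge_of P}. 2)"
  proof (rule sum_mono)
    fix E assume "E \<in> {E. E edge_of P}"
    then have E: "E face_of P" "aff_dim E = 1" "E edge_of P" by (auto simp: edge_of_def)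
    have "finite (E \<inter> D)"
      using E(3) by (intro finite_subset[OF _ assms(3)]) (auto simp: P(2))
    then show "card (E \<inter> D) \<le> 2"
      unfolding Q(1)
    proof (intro card_collinear_Int_frontier_le_2)
      show "convex E" by (rule face_of_imp_convex[OF E(1)])
      show "collinear E" using E(2) by (simp add: collinear_aff_dim)
    qed (simp_all add: Q compact_imp_closed)
  qed
  also have "\<dots> = 2 * n" using P(1) by simp
  finally show ?thesis .
qed

section \<open>The fold of a node\<close>

definition open_ray :: "'a::real_vector \<Rightarrow> real \<Rightarrow> 'a \<Rightarrow> 'a set" where
  "open_ray p r d = (\<lambda>t. p + t *\<^sub>R d) ` {0<..<r}"

text \<open>Near a point \<open>p\<close> only the constraints that are active at \<open>p\<close> matter, and these are
  homogeneous in \<open>x - p\<close>.\<close>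

lemma frontier_polyhedron_locally_conic:
  fixes P :: "'a::euclidean_space set"
  assumes "polyhedron P" "p \<in> frontier P"
  obtains r where "r > 0"
    "\<And>x t. x \<in> frontier P \<Longrightarrow> x \<in> ball p r \<Longrightarrow> 0 < t \<Longrightarrow> p + t *\<^sub>R (x - p) \<in> ball p r
      \<Longrightarrow> p + t *\<^sub>R (x - p) \<in> frontier P"
proof -
  obtain F where F: "finite F" "P = \<Inter>F" "\<forall>h\<in>F. \<exists>a b. a \<noteq> 0 \<and> h = {x. a \<bullet> x \<le> b}"
    using assms(1) unfolding polyhedron_def by blast
  then obtain a b where ab: "\<And>h. h \<in> F \<Longrightarrow> a h \<noteq> 0 \<and> h = {x. a h \<bullet> x \<le> b h}"
    by metis
  have mem: "x \<in> P \<longleftrightarrow> (\<forall>h\<in>F. a h \<bullet> x \<le> b h)" for x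
    using ab unfolding F(2) by blast
  have inth: "interior h = {x. a h \<bullet> x < b h}" if "h \<in> F" for h
    using ab[OF that] interior_halfspace_le[of "a h" "b h"] by metis
  have "interior P = (\<Inter>h\<in>F. interior h)"
    using F(1) unfolding F(2) by (induction F) auto
  then have int: "x \<in> interior P \<longleftrightarrow> (\<forall>h\<in>F. a h \<bullet> x < b h)" for x
    using inth by auto
  have fr: "x \<in> frontier P \<longleftrightarrow> (\<forall>h\<in>F. a h \<bullet> x \<le> b h) \<and> (\<exists>h\<in>F. a h \<bullet> x = b h)" for x
  proof -
    have "closure P = P"
      using polyhedron_imp_closed[OF assms(1)] by (rule closure_closed)
    then show ?thesis
      using mem[of x] int[of x] by (force simp: frontier_def)
  qed
  define N where "N = {h\<in>F. a h \<bullet> p < b h}"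
  have "open (\<Inter>h\<in>N. {x. a h \<bullet> x < b h})" "p \<in> (\<Inter>h\<in>N. {x. a h \<bullet> x < b h})"
    using F(1) by (auto simp: N_def open_halfspace_lt)
  then obtain r where r: "r > 0" "ball p r \<subseteq> (\<Inter>h\<in>N. {x. a h \<bullet> x < b h})"
    by (meson openE)
  have act: "a h \<bullet> p = b h" if "h \<in> F - N" for h
    using that assms(2) unfolding fr N_def by force
  have loc: "x \<in> frontier P \<longleftrightarrow>
      (\<forall>h\<in>F-N. a h \<bullet> (x - p) \<le> 0) \<and> (\<exists>h\<in>F-N. a h \<bullet> (x - p) = 0)"
    if "x \<in> ball p r" for x
  proof -
    have 1: "a h \<bullet> x < b h" if "h \<in> N" for h
      using r(2) \<open>x \<in> ball p r\<close> that by blast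
    have 2: "a h \<bullet> x = b h + a h \<bullet> (x - p)" if "h \<in> F - N" for h
      using act[OF that] by (simp add: inner_diff_right)
    have "(\<forall>h\<in>F. a h \<bullet> x \<le> b h) \<longleftrightarrow> (\<forall>h\<in>F-N. a h \<bullet> (x - p) \<le> 0)"
      using 1 2 by force
    moreover have "(\<exists>h\<in>F. a h \<bullet> x = b h) \<longleftrightarrow> (\<exists>h\<in>F-N. a h \<bullet> (x - p) = 0)"
      using 1 2 by force
    ultimately show ?thesis unfolding fr by simp
  qed
  show thesis
  proof (rule that[OF r(1)])
    fix x t assume *: "x \<in> frontier P" "x \<in> ball p r" "0 < (t::real)" "p + t *\<^sub>R (x - p) \<in> ball p r"
    show "p + t *\<^sub>R (x - p) \<in> frontier P"
      using *(1,3) unfolding loc[OF *(2)] loc[OF *(4)] by (auto simp: mult_le_0_iff)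
  qed
qed

text \<open>Fix an interior point \<open>q\<close>. The line through \<open>p\<close> and \<open>q\<close> has no boundary point near \<open>p\<close>
  other than \<open>p\<close>. On either of its sides there is a boundary direction, because a small half-disc
  contains interior and exterior points, and only one, because of two directions on the same side
  one lies between the other and \<open>q - p\<close> and therefore points into the interior.\<close>

lemma frontier_locally_two_rays:
  fixes P :: "(real^2) set"
  assumes "polyhedron P" "interior P \<noteq> {}" "p \<in> frontier P"
  obtains D r where "card D = 2" "\<And>d. d \<in> D \<Longrightarrow> norm d = 1" "r > 0"
    "frontier P \<inter> ball p r - {p} = (\<Union>d\<in>D. open_ray p r d)"
proof -
  have convP: "convex P" and clP: "closed P"
    using assms(1) polyhedron_imp_convex polyhedron_imp_closed by blast+
  then have frP: "frontier P \<subseteq> P" and pP: "p \<in> P"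
    using assms(3) frontier_subset_closed by blast+
  have pint: "p \<notin> interior P" using assms(3) by (simp add: frontier_def)
  obtain q where q: "q \<in> interior P" using assms(2) by blast
  define w where "w = q - p"
  have "w \<noteq> 0" using q pint by (auto simp: w_def)
  obtain r where r: "r > 0" and conic:
    "\<And>x t. x \<in> frontier P \<Longrightarrow> x \<in> ball p r \<Longrightarrow> 0 < t \<Longrightarrow> p + t *\<^sub>R (x - p) \<in> ball p r
      \<Longrightarrow> p + t *\<^sub>R (x - p) \<in> frontier P"
    using frontier_polyhedron_locally_conic[OF assms(1,3)] by blast
  \<comment> \<open>The sign of \<open>e \<bullet> (x - p)\<close> tells the two sides of the line through \<open>p\<close> and \<open>q\<close> apart.\<close>
  define e :: "real^2" where "e = vector [- w$2, w$1]"
  have e_w: "e \<bullet> w = 0"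
    by (simp add: e_def inner_vec_def sum_2)
  have "e \<noteq> 0"
    using \<open>w \<noteq> 0\<close> by (auto simp: e_def vec_eq_iff forall_2)
  have parallel: "\<exists>l. z = l *\<^sub>R w" if "e \<bullet> z = 0" for z
  proof -
    have z: "w$1 * z$2 = w$2 * z$1"
      using that by (simp add: e_def inner_vec_def sum_2)
    have "z = (if w$1 = 0 then z$2 / w$2 else z$1 / w$1) *\<^sub>R w"
      using z \<open>w \<noteq> 0\<close> by (auto simp: vec_eq_iff forall_2 field_simps)
    then show ?thesis by blast
  qed
  have shrink: "x + s *\<^sub>R (q - x) \<in> interior P" if "x \<in> P" "0 < s" "s \<le> 1" for x s
    using mem_interior_closure_convex_shrink[OF convP q, of x s] that closure_subset[of P]
    by (auto simp: algebra_simps)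
  have inward: "\<exists>k0>0. \<forall>k. 0 < k \<and> k \<le> k0 \<longrightarrow> p + k *\<^sub>R (\<alpha> *\<^sub>R (x - p) + l *\<^sub>R w) \<in> interior P"
    if "x \<in> P" "0 \<le> \<alpha>" "0 < l" for x \<alpha> l
  proof (intro exI conjI allI impI)
    show "0 < 1 / (\<alpha> + l + 1)" using that by simp
    fix k assume k: "0 < k \<and> k \<le> 1 / (\<alpha> + l + 1)"
    have kal: "k * \<alpha> + k * l < 1"
    proof -
      have "k * (\<alpha> + l + 1) \<le> 1" using k that by (simp add: field_simps)
      then show ?thesis using k by (simp add: algebra_simps)
    qed
    have kl: "0 < k * l" and "k * l < 1" and ka: "0 \<le> k * \<alpha>"
      using k that kal by (auto intro: add_nonneg_pos) (smt (verit) mult_nonneg_nonneg)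
    define \<mu> where "\<mu> = k * \<alpha> / (1 - k * l)"
    have mu: "0 \<le> \<mu>" "\<mu> \<le> 1" "(1 - k * l) * \<mu> = k * \<alpha>"
      using ka kal \<open>k * l < 1\<close> by (auto simp: \<mu>_def field_simps)
    define z where "z = p + \<mu> *\<^sub>R (x - p)"
    have "z = (1 - \<mu>) *\<^sub>R p + \<mu> *\<^sub>R x"
      by (simp add: z_def algebra_simps)
    then have "z \<in> P"
      using convexD_alt[OF convP pP \<open>x \<in> P\<close> mu(1,2)] by simp
    then have "z + (k * l) *\<^sub>R (q - z) \<in> interior P"
      using shrink kl \<open>k * l < 1\<close> by simp
    also have "z + (k * l) *\<^sub>R (q - z) = p + ((1 - k * l) * \<mu>) *\<^sub>R (x - p) + (k * l) *\<^sub>R (q - p)"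
      by (simp add: z_def algebra_simps)
    also have "\<dots> = p + k *\<^sub>R (\<alpha> *\<^sub>R (x - p) + l *\<^sub>R w)"
      unfolding mu(3) w_def by (simp add: algebra_simps)
    finally show "p + k *\<^sub>R (\<alpha> *\<^sub>R (x - p) + l *\<^sub>R w) \<in> interior P" .
  qed
  define B where "B = frontier P \<inter> ball p r"
  have BP: "x \<in> P" if "x \<in> B" for x using that frP by (auto simp: B_def)
  \<comment> \<open>Otherwise the points of the segment from \<open>p\<close> to \<open>y\<close> close to \<open>p\<close> would lie both on the boundary
    and in the interior.\<close>
  have not_inward: False
    if y: "y \<in> B" "y - p = \<alpha> *\<^sub>R (x - p) + l *\<^sub>R w" and x: "x \<in> P" "0 \<le> \<alpha>" "0 < l" for x y \<alpha> l
  proof -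
    obtain k0 where k0: "k0 > 0"
      "\<And>k. 0 < k \<and> k \<le> k0 \<Longrightarrow> p + k *\<^sub>R (\<alpha> *\<^sub>R (x - p) + l *\<^sub>R w) \<in> interior P"
      using inward[OF x] by blast
    define k where "k = min k0 1"
    have k: "0 < k" "k \<le> k0" "k \<le> 1" using k0(1) by (auto simp: k_def)
    have "p + k *\<^sub>R (y - p) \<in> interior P"
      using k0(2)[of k] k unfolding y(2) by simp
    moreover have "norm (k *\<^sub>R (y - p)) < r"
    proof -
      have "norm (y - p) < r" using y(1) by (simp add: B_def dist_norm norm_minus_commute)
      moreover have "norm (k *\<^sub>R (y - p)) \<le> 1 * norm (y - p)"
        unfolding norm_scaleR using k by (intro mult_right_mono) auto
      ultimately show ?thesis by simp
    qed
    then have "p + k *\<^sub>R (y - p) \<in> frontier P"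
      using y(1) k by (intro conic) (auto simp: B_def dist_norm)
    ultimately show False by (simp add: frontier_def)
  qed
  have not_back: False if "p - l *\<^sub>R w \<in> P" "0 < l" for l
  proof -
    have "(p - l *\<^sub>R w) + (l / (1 + l)) *\<^sub>R (q - (p - l *\<^sub>R w)) \<in> interior P"
      using that by (intro shrink) auto
    also have "q - (p - l *\<^sub>R w) = (1 + l) *\<^sub>R w"
      unfolding w_def by (simp add: algebra_simps)
    also have "(p - l *\<^sub>R w) + (l / (1 + l)) *\<^sub>R ((1 + l) *\<^sub>R w) = p"
      using that(2) by simp
    finally show False using pint by simp
  qed
  have off_axis: "e \<bullet> (y - p) \<noteq> 0" if y: "y \<in> B" "y \<noteq> p" for y
  proof
    assume "e \<bullet> (y - p) = 0"
    then obtain l where l: "y - p = l *\<^sub>R w" using parallel by blast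
    then have "l \<noteq> 0" using y by auto
    moreover have False if "l > 0"
      using not_inward[OF y(1) _ pP, of 0 l] l that by simp
    moreover have False if "l < 0"
      using not_back[of "-l"] BP[OF y(1)] l that by (simp add: algebra_simps)
    ultimately show False by linarith
  qed
  have unique: "\<exists>t>0. y - p = t *\<^sub>R (x - p)"
    if xy: "x \<in> B" "y \<in> B" "(e \<bullet> (x - p)) * (e \<bullet> (y - p)) > 0" for x y
  proof -
    define t where "t = (e \<bullet> (y - p)) / (e \<bullet> (x - p))"
    have t: "t > 0"
      using xy(3) by (auto simp: t_def zero_less_mult_iff zero_less_divide_iff)
    have "e \<bullet> ((y - p) - t *\<^sub>R (x - p)) = 0"
      using xy(3) by (auto simp: t_def inner_diff_right)
    then obtain l where l: "(y - p) - t *\<^sub>R (x - p) = l *\<^sub>R w" using parallel by blast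
    have False if "l > 0"
      using not_inward[OF xy(2) _ BP[OF xy(1)], of t l] l t that by (simp add: algebra_simps)
    moreover have False if "l < 0"
    proof -
      have "x - p = (1 / t) *\<^sub>R (t *\<^sub>R (x - p))" using t by simp
      also have "t *\<^sub>R (x - p) = (y - p) - l *\<^sub>R w" using l by (simp add: algebra_simps)
      finally have "x - p = (1 / t) *\<^sub>R (y - p) + (- l / t) *\<^sub>R w"
        by (simp add: scaleR_diff_right)
      then show False
        using not_inward[OF xy(1) _ BP[OF xy(2)], of "1 / t" "- l / t"] t that
        by (simp add: divide_less_0_iff)
    qed
    ultimately have "l = 0" using linorder_neqE_linordered_idom[of l 0] by blast
    with l t show ?thesis by auto
  qed
  have ex: "\<exists>x\<in>B. \<sigma> * (e \<bullet> (x - p)) > 0" if "\<sigma> = 1 \<or> \<sigma> = -1" for \<sigma>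
  proof -
    define H where "H = ball p r \<inter> {x. (\<sigma> *\<^sub>R e) \<bullet> x > (\<sigma> *\<^sub>R e) \<bullet> p}"
    have "convex H"
      unfolding H_def by (intro convex_Int convex_ball convex_halfspace_gt)
    \<comment> \<open>The points \<open>p \<plusminus> k *\<^sub>R w\<close> lie on the diameter of the half-disc; push them off it.\<close>
    have reach: "\<exists>x\<in>H. x \<in> U" if "open U" "p + k *\<^sub>R w \<in> U" "\<bar>k\<bar> * norm w < r" for U k
    proof -
      have "open (U \<inter> ball p r)" "p + k *\<^sub>R w \<in> U \<inter> ball p r"
        using that by (auto simp: dist_norm)
      then obtain \<delta> where \<delta>: "\<delta> > 0" "ball (p + k *\<^sub>R w) \<delta> \<subseteq> U \<inter> ball p r"
        by (meson openE)
      define x where "x = p + k *\<^sub>R w + (\<delta> / 2 / norm e) *\<^sub>R (\<sigma> *\<^sub>R e)"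
      have "x \<in> ball (p + k *\<^sub>R w) \<delta>"
        using \<delta>(1) \<open>e \<noteq> 0\<close> \<open>\<sigma> = 1 \<or> \<sigma> = -1\<close> by (auto simp: x_def dist_norm)
      moreover have "(\<sigma> *\<^sub>R e) \<bullet> x > (\<sigma> *\<^sub>R e) \<bullet> p"
        using \<delta>(1) \<open>e \<noteq> 0\<close> \<open>\<sigma> = 1 \<or> \<sigma> = -1\<close> by (auto simp: x_def inner_add_right e_w)
      ultimately have "x \<in> H" "x \<in> U" using \<delta>(2) unfolding H_def by blast+
      then show ?thesis by blast
    qed
    obtain k0 where k0: "k0 > 0" "\<And>k. 0 < k \<and> k \<le> k0 \<Longrightarrow> p + k *\<^sub>R w \<in> interior P"
      using inward[OF pP, of 0 1] by auto
    define k where "k = min k0 (r / 2 / norm w)"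
    have "norm w > 0" using \<open>w \<noteq> 0\<close> by simp
    have k: "0 < k" "k \<le> k0" using k0(1) r \<open>norm w > 0\<close> by (auto simp: k_def)
    have "k * norm w \<le> (r / 2 / norm w) * norm w"
      using \<open>norm w > 0\<close> by (intro mult_right_mono) (auto simp: k_def)
    then have kr: "\<bar>k\<bar> * norm w < r" using k r \<open>norm w > 0\<close> by simp
    have "H \<inter> P \<noteq> {}"
      using reach[OF open_interior _ kr] k0(2) k interior_subset[of P] by blast
    moreover have "H - P \<noteq> {}"
      using reach[of "- P" "-k"] clP not_back[of k] k kr by (auto simp: open_Compl)
    ultimately have "H \<inter> frontier P \<noteq> {}"
      using \<open>convex H\<close> convex_connected connected_Int_frontier by blast
    then show ?thesis by (auto simp: H_def B_def inner_diff_right algebra_simps)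
  qed
  obtain x1 where x1: "x1 \<in> B" "e \<bullet> (x1 - p) > 0" using ex[of 1] by auto
  obtain x2 where x2: "x2 \<in> B" "e \<bullet> (x2 - p) < 0" using ex[of "-1"] by auto
  define dir where "dir x = (1 / norm (x - p)) *\<^sub>R (x - p)" for x
  have xp: "x1 \<noteq> p" "x2 \<noteq> p" using x1 x2 by auto
  have "e \<bullet> dir x1 > 0" "e \<bullet> dir x2 < 0"
    using x1(2) x2(2) xp by (auto simp: dir_def divide_less_0_iff)
  then have "dir x1 \<noteq> dir x2" by auto
  have ray: "open_ray p r (dir x) \<subseteq> B - {p}" if x: "x \<in> B" "x \<noteq> p" for x
  proof
    fix y assume "y \<in> open_ray p r (dir x)"
    then obtain t where t: "0 < t" "t < r" "y = p + (t / norm (x - p)) *\<^sub>R (x - p)"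
      by (auto simp: open_ray_def dir_def)
    have "norm (y - p) = t" using t x by simp
    then have "y \<in> ball p r" "y \<noteq> p" using t by (auto simp: dist_norm norm_minus_commute)
    moreover have "y \<in> frontier P"
      unfolding t(3) using x t(1) \<open>y \<in> ball p r\<close>[unfolded t(3)]
      by (intro conic) (auto simp: B_def)
    ultimately show "y \<in> B - {p}" by (simp add: B_def)
  qed
  have on_ray: "y \<in> open_ray p r (dir x)"
    if xy: "x \<in> B" "y \<in> B" "(e \<bullet> (x - p)) * (e \<bullet> (y - p)) > 0" for x y
  proof -
    obtain t where t: "t > 0" "y - p = t *\<^sub>R (x - p)" using unique[OF xy] by blast
    have "x \<noteq> p" using xy(3) by auto
    have "norm (y - p) = t * norm (x - p)" using t by simp
    moreover have "norm (y - p) < r" using xy(2) by (simp add: B_def dist_norm norm_minus_commute)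
    moreover have "y = p + (t * norm (x - p)) *\<^sub>R dir x"
      using t(2) \<open>x \<noteq> p\<close> by (simp add: dir_def algebra_simps)
    ultimately show ?thesis
      unfolding open_ray_def using t(1) \<open>x \<noteq> p\<close> by (intro image_eqI[of _ _ "t * norm (x - p)"]) auto
  qed
  show thesis
  proof (rule that[of "{dir x1, dir x2}" r])
    show "card {dir x1, dir x2} = 2" using \<open>dir x1 \<noteq> dir x2\<close> by simp
    show "norm d = 1" if "d \<in> {dir x1, dir x2}" for d
      using that xp by (auto simp: dir_def)
    show "frontier P \<inter> ball p r - {p} = (\<Union>d\<in>{dir x1, dir x2}. open_ray p r d)"
    proof
      show "(\<Union>d\<in>{dir x1, dir x2}. open_ray p r d) \<subseteq> frontier P \<inter> ball p r - {p}"
        using ray[OF x1(1) xp(1)] ray[OF x2(1) xp(2)] by (auto simp: B_def)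
      show "frontier P \<inter> ball p r - {p} \<subseteq> (\<Union>d\<in>{dir x1, dir x2}. open_ray p r d)"
      proof
        fix y assume "y \<in> frontier P \<inter> ball p r - {p}"
        then have y: "y \<in> B" "y \<noteq> p" by (auto simp: B_def)
        then consider "e \<bullet> (y - p) > 0" | "e \<bullet> (y - p) < 0"
          using off_axis by (meson linorder_neqE_linordered_idom)
        then show "y \<in> (\<Union>d\<in>{dir x1, dir x2}. open_ray p r d)"
          using on_ray[OF x1(1) y(1)] on_ray[OF x2(1) y(1)] x1(2) x2(2)
          by cases (auto simp: mult_neg_neg)
      qed
    qed
  qed (rule r)
qed

text \<open>For \<open>p\<close> off the curve the set of directions is empty, so that all curves of a family can be
  treated alike.\<close>

lemma convex_ngon_locally_rays:
  assumes "convex_ngon n C"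
  shows "\<exists>D. finite D \<and> card D = (if p \<in> C then 2 else 0) \<and> (\<forall>d\<in>D. norm d = 1) \<and>
    (\<forall>\<^sub>F r in at_right 0. (C - {p}) \<inter> ball p r = (\<Union>d\<in>D. open_ray p r d))"
proof (cases "p \<in> C")
  case True
  obtain P where P: "C = frontier P" "polyhedron P" "interior P \<noteq> {}"
    by (rule convex_ngonE[OF assms]) (rule that; assumption)
  obtain D r0 where D: "card D = 2" "\<And>d. d \<in> D \<Longrightarrow> norm d = 1" "r0 > 0"
    "C \<inter> ball p r0 - {p} = (\<Union>d\<in>D. open_ray p r0 d)"
    using frontier_locally_two_rays[of P p] P True by metis
  have "(C - {p}) \<inter> ball p r = (\<Union>d\<in>D. open_ray p r d)" if "0 < r" "r < r0" for r
  proof -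
    have "(C - {p}) \<inter> ball p r = (C \<inter> ball p r0 - {p}) \<inter> ball p r"
      using that by auto
    also have "\<dots> = (\<Union>d\<in>D. open_ray p r0 d \<inter> ball p r)"
      unfolding D(4) by blast
    also have "\<dots> = (\<Union>d\<in>D. open_ray p r d)"
      using that D(2) by (intro SUP_cong refl) (auto simp: open_ray_def dist_norm)
    finally show ?thesis .
  qed
  then have "\<forall>\<^sub>F r in at_right 0. (C - {p}) \<inter> ball p r = (\<Union>d\<in>D. open_ray p r d)"
    using D(3) unfolding eventually_at_right_field by blast
  moreover have "finite D" using D(1) by (intro card_ge_0_finite) simp
  ultimately show ?thesis using D(1,2) True by auto
next
  case False
  then obtain r0 where r0: "r0 > 0" "ball p r0 \<subseteq> - C"
    using closed_convex_ngon[OF assms] by (metis ComplI openE open_Compl)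
  have "(C - {p}) \<inter> ball p r = {}" if "0 < r" "r < r0" for r
    using r0(2) that subset_ball[of r r0 p] by auto
  then have "\<forall>\<^sub>F r in at_right 0. (C - {p}) \<inter> ball p r = {}"
    using r0(1) unfolding eventually_at_right_field by blast
  then show ?thesis using False by (intro exI[of _ "{}"]) simp
qed

text \<open>The direction \<open>(x - p) / norm (x - p)\<close> is continuous in \<open>x\<close> and takes finitely many values
  on a finite union of rays, hence is constant on connected subsets.\<close>

lemma components_Union_open_rays:
  fixes p :: "'a::euclidean_space"
  assumes "finite D" "\<And>d. d \<in> D \<Longrightarrow> norm d = 1" "0 < r"
  shows "components (\<Union>d\<in>D. open_ray p r d) = open_ray p r ` D"
    and "inj_on (open_ray p r) D"
proof -
  define f where "f x = (1 / norm (x - p)) *\<^sub>R (x - p)" for x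
  have f: "f x = d" "x \<noteq> p" if "x \<in> open_ray p r d" "d \<in> D" for x d
    using assms(2)[OF that(2)] that(1) by (auto simp: f_def open_ray_def)
  have ne: "open_ray p r d \<noteq> {}" for d
    using assms(3) by (simp add: open_ray_def)
  have conn: "connected (open_ray p r d)" for d
    unfolding open_ray_def by (intro connected_continuous_image continuous_intros) auto
  show "inj_on (open_ray p r) D"
  proof (rule inj_onI)
    fix d d' assume d: "d \<in> D" "d' \<in> D" "open_ray p r d = open_ray p r d'"
    obtain x where x: "x \<in> open_ray p r d" using ne[of d] by blast
    then have "x \<in> open_ray p r d'" using d(3) by simp
    then show "d = d'" using f(1)[OF x d(1)] f(1)[OF _ d(2)] by simp
  qed
  let ?X = "\<Union>d\<in>D. open_ray p r d"
  have in_ray: "\<exists>d\<in>D. S \<subseteq> open_ray p r d" if S: "connected S" "S \<subseteq> ?X" "S \<noteq> {}" for S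
  proof -
    have "continuous_on S f"
      unfolding f_def using f(2) S(2) by (intro continuous_intros) fastforce
    then have "connected (f ` S)" using S(1) connected_continuous_image by blast
    moreover have "f ` S \<subseteq> D" using f(1) S(2) by blast
    moreover from this have "finite (f ` S)" by (rule finite_subset[OF _ assms(1)])
    ultimately obtain d where d: "f ` S = {d}"
      using S(3) connected_finite_iff_sing[of "f ` S"] by blast
    have "S \<subseteq> open_ray p r d"
    proof
      fix x assume x: "x \<in> S"
      then obtain d' where d': "d' \<in> D" "x \<in> open_ray p r d'" using S(2) by blast
      then have "d' = d" using f(1)[OF d'(2,1)] d x by auto
      then show "x \<in> open_ray p r d" using d' by simp
    qed
    moreover have "d \<in> D" using d \<open>f ` S \<subseteq> D\<close> by blast
    ultimately show ?thesis by blast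
  qed
  show "components ?X = open_ray p r ` D"
  proof
    show "components ?X \<subseteq> open_ray p r ` D"
    proof
      fix S assume S: "S \<in> components ?X"
      then obtain d where d: "d \<in> D" "S \<subseteq> open_ray p r d"
        using in_ray in_components_connected in_components_subset in_components_nonempty by metis
      then have "open_ray p r d = S"
        using S conn[of d] ne[of d] unfolding in_components_maximal by blast
      then show "S \<in> open_ray p r ` D" using d by blast
    qed
    show "open_ray p r ` D \<subseteq> components ?X"
    proof
      fix S assume "S \<in> open_ray p r ` D"
      then obtain d where d: "d \<in> D" "S = open_ray p r d" by blast
      have "T = S" if T: "T \<noteq> {}" "S \<subseteq> T" "T \<subseteq> ?X" "connected T" for T
      proof -
        obtain d' where d': "d' \<in> D" "T \<subseteq> open_ray p r d'"
          using in_ray T by blast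
        obtain x where x: "x \<in> open_ray p r d" using ne[of d] by blast
        then have "x \<in> open_ray p r d'" using d(2) d'(2) T(2) by blast
        then have "d' = d" using f(1)[OF x d(1)] f(1)[OF _ d'(1)] by simp
        then show ?thesis using d(2) d'(2) T(2) by simp
      qed
      then show "S \<in> components ?X"
        unfolding in_components_maximal using conn[of d] ne[of d] d by simp blast
    qed
  qed
qed

text \<open>Every curve through \<open>p\<close> contributes two rays, and curves with finite intersection share none.\<close>

lemma node_fold_eq:
  assumes "finite F" "\<And>C. C \<in> F \<Longrightarrow> \<exists>n. convex_ngon n C" "finite (nodes F)"
  shows "node_fold F p = 2 * card {C \<in> F. p \<in> C}"
proof -
  define rays where "rays C D \<longleftrightarrow> finite D \<and> card D = (if p \<in> C then 2 else 0) \<and>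
    (\<forall>d\<in>D. norm d = 1) \<and>
    (\<forall>\<^sub>F r in at_right 0. (C - {p}) \<inter> ball p r = (\<Union>d\<in>D. open_ray p r d))" for C D
  have "\<forall>C\<in>F. \<exists>D. rays C D"
    using assms(2) convex_ngon_locally_rays[of _ _ p] unfolding rays_def by blast
  then obtain D where D: "\<And>C. C \<in> F \<Longrightarrow> rays C (D C)"
    unfolding bchoice_iff by blast
  have ev: "\<forall>\<^sub>F r in at_right 0. \<forall>C\<in>F. (C - {p}) \<inter> ball p r = (\<Union>d\<in>D C. open_ray p r d)"
    using assms(1) D unfolding rays_def by (intro eventually_ball_finite) blast+
  have pos: "\<forall>\<^sub>F r in at_right 0. (0::real) < r"
    by (rule eventually_at_right_less)
  have disj: "D C \<inter> D C' = {}" if C: "C \<in> F" "C' \<in> F" "C \<noteq> C'" for C C'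
  proof (rule ccontr)
    assume "D C \<inter> D C' \<noteq> {}"
    then obtain d where d: "d \<in> D C" "d \<in> D C'" by blast
    obtain r where r: "0 < r" "\<forall>C\<in>F. (C - {p}) \<inter> ball p r = (\<Union>d\<in>D C. open_ray p r d)"
      using eventually_happens'[OF _ eventually_conj[OF ev pos]] by (auto simp: trivial_limit_at_right_real)
    have "open_ray p r d \<subseteq> C" "open_ray p r d \<subseteq> C'"
      using r(2) C d by blast+
    then have "open_ray p r d \<subseteq> nodes F"
      using C unfolding nodes_def by blast
    then have "finite (open_ray p r d)"
      by (rule finite_subset[OF _ assms(3)])
    moreover have "d \<noteq> 0" using D[OF C(1)] d(1) unfolding rays_def by force
    then have "inj_on (\<lambda>t. p + t *\<^sub>R d) {0<..<r}" by (auto intro: inj_onI)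
    ultimately have "finite {0<..<r}"
      unfolding open_ray_def by (rule finite_imageD)
    then show False using r(1) by (simp add: infinite_Ioo)
  qed
  define E where "E = (\<Union>C\<in>F. D C)"
  have E: "finite E" "\<And>d. d \<in> E \<Longrightarrow> norm d = 1"
    using D assms(1) unfolding rays_def E_def by blast+
  have "card E = (\<Sum>C\<in>F. card (D C))"
    unfolding E_def using disj D assms(1) by (intro card_UN_disjoint) (auto simp: rays_def)
  also have "\<dots> = (\<Sum>C\<in>F. if p \<in> C then 2 else 0)"
    using D unfolding rays_def by (intro sum.cong refl) blast
  also have "\<dots> = 2 * card {C \<in> F. p \<in> C}"
    using assms(1) by (simp add: sum.If_cases Int_def)
  finally have cardE: "card E = 2 * card {C \<in> F. p \<in> C}" .
  have main: "\<forall>\<^sub>F r in at_right 0. finite (components ((\<Union>F - {p}) \<inter> ball p r)) \<and>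
     card (components ((\<Union>F - {p}) \<inter> ball p r)) = 2 * card {C \<in> F. p \<in> C}"
    using ev pos
  proof eventually_elim
    case (elim r)
    have "(\<Union>F - {p}) \<inter> ball p r = (\<Union>C\<in>F. (C - {p}) \<inter> ball p r)" by blast
    also have "\<dots> = (\<Union>d\<in>E. open_ray p r d)"
      using elim(1) unfolding E_def by simp
    finally show ?case
      using components_Union_open_rays[OF E elim(2)] E(1) cardE
      by (simp add: card_image)
  qed
  show ?thesis
    unfolding node_fold_def
  proof (rule the_equality, rule main)
    fix d assume "\<forall>\<^sub>F r in at_right 0. finite (components ((\<Union>F - {p}) \<inter> ball p r)) \<and>
      card (components ((\<Union>F - {p}) \<inter> ball p r)) = d"
    from eventually_happens'[OF _ eventually_conj[OF this main]]
    show "d = 2 * card {C \<in> F. p \<in> C}" by (auto simp: trivial_limit_at_right_real)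
  qed
qed

section \<open>Counting nodes\<close>

text \<open>A node on \<open>d\<close> curves lies in \<open>d * (d - 1)\<close> of the intersections of ordered pairs of curves.\<close>

lemma sum_card_Int_eq_sum_nodes:
  assumes "finite F" "finite (nodes F)"
  shows "(\<Sum>C\<in>F. \<Sum>D\<in>F-{C}. card (C \<inter> D)) =
    (\<Sum>p\<in>nodes F. card {C \<in> F. p \<in> C} * (card {C \<in> F. p \<in> C} - 1))"
proof -
  have Int: "card (C \<inter> D) = (\<Sum>p\<in>nodes F. of_bool (p \<in> C) * of_bool (p \<in> D))"
    if "C \<in> F" "D \<in> F - {C}" for C D
  proof -
    have "C \<inter> D = {p \<in> nodes F. p \<in> C \<and> p \<in> D}"
      using that by (auto simp: nodes_def)
    then show ?thesis
      using assms(2) by (simp add: of_bool_conj[symmetric] Int_def del: of_bool_conj)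
  qed
  have "(\<Sum>C\<in>F. \<Sum>D\<in>F-{C}. card (C \<inter> D)) =
      (\<Sum>C\<in>F. \<Sum>D\<in>F-{C}. \<Sum>p\<in>nodes F. of_bool (p \<in> C) * of_bool (p \<in> D))"
    by (intro sum.cong refl Int)
  also have "\<dots> = (\<Sum>C\<in>F. \<Sum>p\<in>nodes F. \<Sum>D\<in>F-{C}. of_bool (p \<in> C) * of_bool (p \<in> D))"
    by (intro sum.cong refl sum.swap)
  also have "\<dots> = (\<Sum>p\<in>nodes F. \<Sum>C\<in>F. \<Sum>D\<in>F-{C}. of_bool (p \<in> C) * of_bool (p \<in> D))"
    by (rule sum.swap)
  also have "\<dots> = (\<Sum>p\<in>nodes F. card {C \<in> F. p \<in> C} * (card {C \<in> F. p \<in> C} - 1))"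
  proof (intro sum.cong refl)
    fix p
    let ?S = "{C \<in> F. p \<in> C}"
    have "(\<Sum>D\<in>F-{C}. of_bool (p \<in> C) * of_bool (p \<in> D)) = of_bool (p \<in> C) * (card ?S - 1)"
      if "C \<in> F" for C
    proof (cases "p \<in> C")
      case True
      have "(\<Sum>D\<in>F-{C}. of_bool (p \<in> D)) = card ((F - {C}) \<inter> {D. p \<in> D})"
        using assms(1) by (subst sum_of_bool_eq) auto
      also have "(F - {C}) \<inter> {D. p \<in> D} = ?S - {C}" by auto
      also have "card \<dots> = card ?S - 1"
        using True that by (simp add: card_Diff_singleton)
      finally show ?thesis using True by simp
    qed simp
    then have "(\<Sum>C\<in>F. \<Sum>D\<in>F-{C}. of_bool (p \<in> C) * of_bool (p \<in> D))
        = (\<Sum>C\<in>F. of_bool (p \<in> C) * (card ?S - 1))"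
      by (intro sum.cong refl) auto
    also have "\<dots> = (\<Sum>C\<in>F. of_bool (p \<in> C)) * (card ?S - 1)"
      by (simp add: sum_distrib_right)
    also have "(\<Sum>C\<in>F. of_bool (p \<in> C)) = card ?S"
      using assms(1) by (subst sum_of_bool_eq) (auto simp: Int_def)
    finally show "(\<Sum>C\<in>F. \<Sum>D\<in>F-{C}. of_bool (p \<in> C) * of_bool (p \<in> D)) = card ?S * (card ?S - 1)" .
  qed
  finally show ?thesis .
qed

lemma two_le_card_curves_through_node:
  assumes "finite F" "p \<in> nodes F"
  shows "2 \<le> card {C \<in> F. p \<in> C}"
proof -
  obtain C D where "C \<in> F" "D \<in> F" "C \<noteq> D" "p \<in> C" "p \<in> D"
    using assms(2) unfolding nodes_def by blast
  then have "card {C, D} \<le> card {C \<in> F. p \<in> C}"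
    using assms(1) by (intro card_mono) auto
  then show ?thesis using \<open>C \<noteq> D\<close> by simp
qed

text \<open>For \<open>d \<ge> 2\<close> we have \<open>d * (d - 1) \<ge> 2\<close>, with equality only for \<open>d = 2\<close>.\<close>

lemma two_card_nodes_le:
  assumes "finite F" "finite (nodes F)"
  shows "2 * card (nodes F) \<le> (\<Sum>C\<in>F. \<Sum>D\<in>F-{C}. card (C \<inter> D))"
    and "2 * card (nodes F) = (\<Sum>C\<in>F. \<Sum>D\<in>F-{C}. card (C \<inter> D)) \<longleftrightarrow>
      (\<forall>p\<in>nodes F. card {C \<in> F. p \<in> C} = 2)"
proof -
  let ?d = "\<lambda>p. card {C \<in> F. p \<in> C}"
  have ge: "2 \<le> ?d p * (?d p - 1)" and eq: "2 = ?d p * (?d p - 1) \<longleftrightarrow> ?d p = 2" if "p \<in> nodes F" for p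
  proof -
    have "2 \<le> ?d p" using two_le_card_curves_through_node[OF assms(1) that] .
    then obtain k where k: "?d p = Suc (Suc k)" by (metis add_2_eq_Suc le_Suc_ex)
    show "2 \<le> ?d p * (?d p - 1)" unfolding k by simp
    show "2 = ?d p * (?d p - 1) \<longleftrightarrow> ?d p = 2" unfolding k by auto
  qed
  have two: "2 * card (nodes F) = (\<Sum>p\<in>nodes F. 2)" by simp
  show "2 * card (nodes F) \<le> (\<Sum>C\<in>F. \<Sum>D\<in>F-{C}. card (C \<inter> D))"
    unfolding sum_card_Int_eq_sum_nodes[OF assms] two by (intro sum_mono ge)
  show "2 * card (nodes F) = (\<Sum>C\<in>F. \<Sum>D\<in>F-{C}. card (C \<inter> D)) \<longleftrightarrow> (\<forall>p\<in>nodes F. ?d p = 2)"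
  proof
    assume "2 * card (nodes F) = (\<Sum>C\<in>F. \<Sum>D\<in>F-{C}. card (C \<inter> D))"
    then have *: "(\<Sum>p\<in>nodes F. 2) = (\<Sum>p\<in>nodes F. ?d p * (?d p - 1))"
      unfolding sum_card_Int_eq_sum_nodes[OF assms] two .
    show "\<forall>p\<in>nodes F. ?d p = 2"
      using sum_mono_inv[OF * ge _ assms(2)] eq by blast
  next
    assume *: "\<forall>p\<in>nodes F. ?d p = 2"
    show "2 * card (nodes F) = (\<Sum>C\<in>F. \<Sum>D\<in>F-{C}. card (C \<inter> D))"
      unfolding sum_card_Int_eq_sum_nodes[OF assms] two using * by (intro sum.cong) auto
  qed
qed

definition sides :: "(real^2) set \<Rightarrow> nat" where
  "sides C = (THE n. convex_ngon n C)"

lemma sides_eq: "convex_ngon n C \<Longrightarrow> sides C = n"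
  unfolding sides_def using convex_ngon_unique by blast

definition max_nodes :: "nat \<Rightarrow> (nat \<Rightarrow> nat) \<Rightarrow> (nat \<Rightarrow> nat) \<Rightarrow> nat" where
  "max_nodes k n m = (\<Sum>i=1..k. n i * m i * (m i - 1)) +
     2 * (\<Sum>i=1..k-1. n i * m i * (\<Sum>j=i+1..k. m j))"

text \<open>The sum over ordered pairs of distinct members. A member with \<open>n i\<close> sides contributes \<open>n i\<close> for
  each partner with at least as many sides and \<open>n j\<close> for each smaller partner; interchanging the
  order of summation turns the total of the latter kind into another copy of the former one for
  pairs with different numbers of sides.\<close>

lemma sum_pairs_min:
  fixes w :: "'a \<Rightarrow> nat"
  assumes n: "strict_mono_on {1..k} n"
    and fin: "finite F" and F: "\<And>C. C \<in> F \<Longrightarrow> w C \<in> n ` {1..k}"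
    and m: "\<And>i. i \<in> {1..k} \<Longrightarrow> card {C \<in> F. w C = n i} = m i"
  shows "(\<Sum>C\<in>F. \<Sum>D\<in>F-{C}. min (w C) (w D)) = max_nodes k n m"
proof -
  define G where "G i = {C \<in> F. w C = n i}" for i
  have inj: "inj_on n {1..k}" by (rule strict_mono_on_imp_inj_on[OF n])
  have group: "(\<Sum>C\<in>F. h C) = (\<Sum>i=1..k. \<Sum>C\<in>G i. h C)" for h :: "'a \<Rightarrow> nat"
  proof -
    have "F = (\<Union>i\<in>{1..k}. G i)" using F by (auto simp: G_def)
    then have "(\<Sum>C\<in>F. h C) = (\<Sum>C\<in>(\<Union>i\<in>{1..k}. G i). h C)" by (rule arg_cong)
    also have "\<dots> = (\<Sum>i=1..k. \<Sum>C\<in>G i. h C)"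
    proof (rule sum.UNION_disjoint)
      show "\<forall>i\<in>{1..k}. \<forall>j\<in>{1..k}. i \<noteq> j \<longrightarrow> G i \<inter> G j = {}"
        using inj unfolding G_def inj_on_def by fastforce
      show "\<forall>i\<in>{1..k}. finite (G i)" using fin by (simp add: G_def)
    qed simp
    finally show ?thesis .
  qed
  have min_n: "min (n i) (n j) = n (min i j)" if "i \<in> {1..k}" "j \<in> {1..k}" for i j
    using strict_mono_on_leD[OF n, of i j] strict_mono_on_leD[OF n, of j i] that
    by (cases "i \<le> j") (auto simp: min_def)
  have row: "(\<Sum>D\<in>F-{C}. min (w C) (w D)) =
      (\<Sum>j\<in>{1..<i}. n j * m j) + n i * (m i - 1) + n i * (\<Sum>j\<in>{i+1..k}. m j)"
    if i: "i \<in> {1..k}" and C: "C \<in> G i" for i C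
  proof -
    have wC: "C \<in> F" "w C = n i" using C by (auto simp: G_def)
    have "card (G i) > 0" using C fin by (auto simp: G_def card_gt_0_iff)
    then have "m i \<ge> 1" using m[OF i] by (simp add: G_def)
    have "(\<Sum>D\<in>F-{C}. min (w C) (w D)) + n i = (\<Sum>D\<in>F. min (w C) (w D))"
      using wC fin by (simp add: sum.remove[of F C])
    also have "\<dots> = (\<Sum>j=1..k. \<Sum>D\<in>G j. min (w C) (w D))" by (rule group)
    also have "\<dots> = (\<Sum>j=1..k. n (min i j) * m j)"
    proof (intro sum.cong refl)
      fix j assume j: "j \<in> {1..k}"
      have "(\<Sum>D\<in>G j. min (w C) (w D)) = (\<Sum>D\<in>G j. n (min i j))"
        using min_n[OF i j] wC by (intro sum.cong) (auto simp: G_def)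
      also have "\<dots> = n (min i j) * m j"
        using m[OF j] by (simp add: G_def)
      finally show "(\<Sum>D\<in>G j. min (w C) (w D)) = n (min i j) * m j" .
    qed
    also have "{1..k} = {1..<i} \<union> ({i} \<union> {i+1..k})" using i by auto
    also have "(\<Sum>j\<in>{1..<i} \<union> ({i} \<union> {i+1..k}). n (min i j) * m j) =
        (\<Sum>j\<in>{1..<i}. n (min i j) * m j) + (n i * m i + (\<Sum>j\<in>{i+1..k}. n (min i j) * m j))"
      by (subst sum.union_disjoint; force)+
    also have "(\<Sum>j\<in>{1..<i}. n (min i j) * m j) = (\<Sum>j\<in>{1..<i}. n j * m j)"
      by (intro sum.cong) (auto simp: min_def)
    also have "(\<Sum>j\<in>{i+1..k}. n (min i j) * m j) = n i * (\<Sum>j\<in>{i+1..k}. m j)"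
      unfolding sum_distrib_left by (intro sum.cong) (auto simp: min_def)
    also have "n i * m i = n i * (m i - 1) + n i"
      using \<open>m i \<ge> 1\<close> by (cases "m i") auto
    finally show ?thesis by linarith
  qed
  have "(\<Sum>C\<in>F. \<Sum>D\<in>F-{C}. min (w C) (w D)) =
      (\<Sum>i=1..k. \<Sum>C\<in>G i. \<Sum>D\<in>F-{C}. min (w C) (w D))" by (rule group)
  also have "\<dots> = (\<Sum>i=1..k. \<Sum>C\<in>G i.
      (\<Sum>j\<in>{1..<i}. n j * m j) + n i * (m i - 1) + n i * (\<Sum>j\<in>{i+1..k}. m j))"
    by (intro sum.cong refl row)
  also have "\<dots> = (\<Sum>i=1..k. m i * ((\<Sum>j\<in>{1..<i}. n j * m j) + n i * (m i - 1) + n i * (\<Sum>j\<in>{i+1..k}. m j)))"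
    using m by (intro sum.cong refl) (simp add: G_def)
  also have "\<dots> = (\<Sum>i=1..k. m i * (\<Sum>j\<in>{1..<i}. n j * m j)) + (\<Sum>i=1..k. n i * m i * (m i - 1))
      + (\<Sum>i=1..k. n i * m i * (\<Sum>j\<in>{i+1..k}. m j))"
    by (simp only: sum.distrib[symmetric] distrib_left mult_ac)
  also have "(\<Sum>i=1..k. m i * (\<Sum>j\<in>{1..<i}. n j * m j)) = (\<Sum>i=1..k. n i * m i * (\<Sum>j\<in>{i+1..k}. m j))"
  proof -
    have "(\<Sum>i=1..k. m i * (\<Sum>j\<in>{1..<i}. n j * m j)) = (\<Sum>i=1..k. \<Sum>j=1..<i. n j * m j * m i)"
      by (simp add: sum_distrib_left mult_ac)
    also have "\<dots> = (\<Sum>i\<in>{1..k}. \<Sum>j\<in>{j\<in>{1..k}. j < i}. n j * m j * m i)"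
      by (intro sum.cong refl) auto
    also have "\<dots> = (\<Sum>j\<in>{1..k}. \<Sum>i\<in>{i\<in>{1..k}. j < i}. n j * m j * m i)"
      by (rule sum.swap_restrict) auto
    also have "\<dots> = (\<Sum>j\<in>{1..k}. \<Sum>i\<in>{j+1..k}. n j * m j * m i)"
      by (intro sum.cong refl) auto
    finally show ?thesis by (simp add: sum_distrib_left)
  qed
  also have "(\<Sum>i=1..k. n i * m i * (\<Sum>j\<in>{i+1..k}. m j)) = (\<Sum>i=1..k-1. n i * m i * (\<Sum>j\<in>{i+1..k}. m j))"
    by (intro sum.mono_neutral_right) auto
  finally show ?thesis by (simp add: max_nodes_def)
qed

lemma polygon_familiesD:
  assumes n: "strict_mono_on {1..k} n" and F: "F \<in> polygon_families k n m"
  shows "finite F" "finite (nodes F)" "\<And>C. C \<in> F \<Longrightarrow> convex_ngon (sides C) C"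
    "(\<Sum>C\<in>F. \<Sum>D\<in>F-{C}. min (sides C) (sides D)) = max_nodes k n m"
proof -
  show fin: "finite F" "finite (nodes F)" using F by (auto simp: polygon_families_def)
  have ex: "\<exists>i\<in>{1..k}. convex_ngon (n i) C" if "C \<in> F" for C
    using F that by (auto simp: polygon_families_def)
  then show ngon: "convex_ngon (sides C) C" if "C \<in> F" for C
    using sides_eq[of _ C] ex[OF that] by auto
  show "(\<Sum>C\<in>F. \<Sum>D\<in>F-{C}. min (sides C) (sides D)) = max_nodes k n m"
  proof (rule sum_pairs_min[OF n fin(1)])
    show "sides C \<in> n ` {1..k}" if "C \<in> F" for C
      using ex[OF that] sides_eq[of _ C] by auto
    fix i assume i: "i \<in> {1..k}"
    have "sides C = n i \<longleftrightarrow> convex_ngon (n i) C" if "C \<in> F" for C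
      using ngon[OF that] sides_eq[of "n i" C] by auto
    then have "{C \<in> F. sides C = n i} = {C \<in> F. convex_ngon (n i) C}"
      by blast
    then show "card {C \<in> F. sides C = n i} = m i"
      using F i by (simp add: polygon_families_def)
  qed
qed

text \<open>Both sides of \<open>2 * card (nodes F) \<le> 2 * max_nodes k n m\<close> are compared with the sum of
  \<open>card (C \<inter> D)\<close> over ordered pairs. If they agree, then equality holds in the comparison on the
  left, so exactly two curves pass through each node.\<close>

lemma card_nodes_le:
  assumes n: "strict_mono_on {1..k} n" and F: "F \<in> polygon_families k n m"
  shows "card (nodes F) \<le> max_nodes k n m"
    and "card (nodes F) = max_nodes k n m \<Longrightarrow>
      configuration F = replicate_mset (max_nodes k n m) 4"
proof -
  note D = polygon_familiesD[OF n F]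
  have "card (C \<inter> D) \<le> 2 * min (sides C) (sides D)" if "C \<in> F" "D \<in> F - {C}" for C D
  proof -
    have "C \<inter> D \<subseteq> nodes F" using that by (auto simp: nodes_def)
    then have "finite (C \<inter> D)" using D(2) finite_subset by blast
    then show ?thesis
      using card_Int_convex_ngon_le[OF D(3) D(3), of C D]
        card_Int_convex_ngon_le[OF D(3) D(3), of D C] that by (simp add: Int_commute min_def)
  qed
  then have "(\<Sum>C\<in>F. \<Sum>D\<in>F-{C}. card (C \<inter> D)) \<le> (\<Sum>C\<in>F. \<Sum>D\<in>F-{C}. 2 * min (sides C) (sides D))"
    by (intro sum_mono) auto
  also have "\<dots> = 2 * max_nodes k n m"
    by (simp flip: sum_distrib_left D(4))
  finally have upper: "(\<Sum>C\<in>F. \<Sum>D\<in>F-{C}. card (C \<inter> D)) \<le> 2 * max_nodes k n m" .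
  then show "card (nodes F) \<le> max_nodes k n m"
    using two_card_nodes_le(1)[OF D(1,2)] by linarith
  assume max: "card (nodes F) = max_nodes k n m"
  then have "2 * card (nodes F) = (\<Sum>C\<in>F. \<Sum>D\<in>F-{C}. card (C \<inter> D))"
    using upper two_card_nodes_le(1)[OF D(1,2)] by linarith
  then have "\<forall>p\<in>nodes F. card {C \<in> F. p \<in> C} = 2"
    using two_card_nodes_le(2)[OF D(1,2)] by blast
  then have "\<forall>p\<in>nodes F. node_fold F p = 4"
    using node_fold_eq[OF D(1) _ D(2)] D(3) by fastforce
  then have "configuration F = image_mset (\<lambda>_. 4) (mset_set (nodes F))"
    unfolding configuration_def using D(2) by (intro image_mset_cong) auto
  then show "configuration F = replicate_mset (max_nodes k n m) 4"
    using max by (simp add: image_mset_const_eq)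
qed

lemma maximal_configuration_iff:
  assumes n: "strict_mono_on {1..k} n"
    and ex: "F0 \<in> polygon_families k n m" "card (nodes F0) = max_nodes k n m"
  shows "maximal_configuration (polygon_families k n m) c \<longleftrightarrow> c = replicate_mset (max_nodes k n m) 4"
proof -
  let ?T = "polygon_families k n m"
  have size: "size (configuration F) = card (nodes F)" for F
    by (simp add: configuration_def)
  have c0: "replicate_mset (max_nodes k n m) 4 \<in> configuration ` ?T"
    using card_nodes_le(2)[OF n ex] ex(1) by (metis imageI)
  show ?thesis
  proof
    assume max: "maximal_configuration ?T c"
    then obtain F where F: "F \<in> ?T" "c = configuration F"
      by (auto simp: maximal_configuration_def)
    have "max_nodes k n m \<le> size c"
      using max c0 unfolding maximal_configuration_def by (metis size_replicate_mset)
    then have "card (nodes F) = max_nodes k n m"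
      using card_nodes_le(1)[OF n F(1)] F(2) size by simp
    then show "c = replicate_mset (max_nodes k n m) 4"
      using card_nodes_le(2)[OF n F(1)] F(2) by simp
  next
    assume "c = replicate_mset (max_nodes k n m) 4"
    then show "maximal_configuration ?T c"
      using c0 card_nodes_le(1)[OF n] size by (auto simp: maximal_configuration_def)
  qed
qed

section \<open>Polygons circumscribed about the unit circle\<close>

text \<open>The unit circle is parametrized rationally by
  \<open>v \<mapsto> ((1 - v\<^sup>2) / (1 + v\<^sup>2), 2 * v / (1 + v\<^sup>2))\<close>, so that all conditions become polynomial in \<open>v\<close>.
  The value \<open>tangent_val v x\<close> is \<open>1 + v\<^sup>2\<close> times the signed distance of \<open>x\<close> from the tangent at the
  point with parameter \<open>v\<close>, and it is positive on the side of the circle.\<close>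

definition tangent_val :: "real \<Rightarrow> real^2 \<Rightarrow> real" where
  "tangent_val v x = (1 + x$1) * v\<^sup>2 - 2 * x$2 * v + (1 - x$1)"

definition circumscribed :: "real set \<Rightarrow> (real^2) set" where
  "circumscribed T = {x. \<forall>v\<in>T. 0 \<le> tangent_val v x}"

definition touch :: "real \<Rightarrow> real^2" where
  "touch v = vector [(1 - v\<^sup>2) / (1 + v\<^sup>2), 2 * v / (1 + v\<^sup>2)]"

definition outer_normal :: "real \<Rightarrow> real^2" where
  "outer_normal v = vector [1 - v\<^sup>2, 2 * v]"

definition tangent_dir :: "real \<Rightarrow> real^2" where
  "tangent_dir v = vector [- 2 * v, 1 - v\<^sup>2]"

lemma tangent_val_eq: "tangent_val v x = (1 + v\<^sup>2) - outer_normal v \<bullet> x"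
  by (simp add: tangent_val_def outer_normal_def inner_vec_def sum_2 algebra_simps)

lemma outer_normal_neq_0: "outer_normal v \<noteq> 0"
  by (auto simp: outer_normal_def vec_eq_iff forall_2)

lemma tangent_dir_neq_0: "tangent_dir v \<noteq> 0"
  by (auto simp: tangent_dir_def vec_eq_iff forall_2)

lemma one_plus_square_pos: "0 < 1 + (v::real)\<^sup>2"
  by (smt (verit) zero_le_power2)

lemma tangent_val_tangent_line:
  "tangent_val v (touch s + l *\<^sub>R tangent_dir s) =
    2 * (v - s) * ((v - s) / (1 + s\<^sup>2) - l * (1 + s * v))"
proof -
  have "1 + s\<^sup>2 \<noteq> 0" using one_plus_square_pos[of s] by simp
  then show ?thesis
    by (simp add: tangent_val_def touch_def tangent_dir_def divide_simps)
      (simp add: algebra_simps power2_eq_square)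
qed

lemma tangent_val_touch: "tangent_val v (touch s) = 2 * (v - s)\<^sup>2 / (1 + s\<^sup>2)"
  using tangent_val_tangent_line[of v s 0] by (simp add: power2_eq_square)

lemma tangent_val_touch_pos: "v \<noteq> s \<Longrightarrow> 0 < tangent_val v (touch s)"
  using one_plus_square_pos[of s] by (simp add: tangent_val_touch)

text \<open>The point is the intersection of the tangents at \<open>s\<close> and \<open>t\<close>, because its \<open>tangent_val\<close> is
  a quadratic polynomial in \<open>v\<close> with roots \<open>s\<close> and \<open>t\<close>. The fraction \<open>l\<close> is not reduced: this way
  its sign is visibly that of \<open>(t - s) * (1 + s * t)\<close>.\<close>

lemma tangent_val_meet:
  assumes "1 + s * t \<noteq> 0" "l = (t - s) * (1 + s * t) / ((1 + s\<^sup>2) * (1 + s * t)\<^sup>2)"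
  shows "tangent_val v (touch s + l *\<^sub>R tangent_dir s) =
    2 * ((v - s) * (v - t) * (1 + s * t)) / (1 + s * t)\<^sup>2"
proof -
  have s: "1 + s\<^sup>2 \<noteq> 0" using one_plus_square_pos[of s] by simp
  have l: "l = (t - s) / ((1 + s\<^sup>2) * (1 + s * t))"
    using assms s by (simp add: power2_eq_square)
  have "(v - s) / (1 + s\<^sup>2) - l * (1 + s * v) =
      ((v - s) * (1 + s * t) - (t - s) * (1 + s * v)) / ((1 + s\<^sup>2) * (1 + s * t))"
    unfolding l using s assms(1) by (simp add: diff_divide_distrib left_diff_distrib)
  also have "(v - s) * (1 + s * t) - (t - s) * (1 + s * v) = (v - t) * (1 + s\<^sup>2)"
    by (simp add: algebra_simps power2_eq_square)
  also have "(v - t) * (1 + s\<^sup>2) / ((1 + s\<^sup>2) * (1 + s * t)) = (v - t) / (1 + s * t)"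
    using s by simp
  finally show ?thesis
    unfolding tangent_val_tangent_line using assms(1) by (simp add: power2_eq_square)
qed

lemma tangent_val_convex:
  "tangent_val v ((1 - t) *\<^sub>R x + t *\<^sub>R y) = (1 - t) * tangent_val v x + t * tangent_val v y"
  by (simp add: tangent_val_def algebra_simps)

text \<open>As a polynomial in \<open>v\<close>, the function \<open>\<lambda>v. tangent_val v x\<close> has degree at most two, and it does not
  vanish identically, because \<open>1 + x$1\<close> and \<open>1 - x$1\<close> are not both zero.\<close>

lemma no_three_tangents:
  assumes "tangent_val u x = 0" "tangent_val v x = 0" "tangent_val w x = 0"
    "u \<noteq> v" "u \<noteq> w" "v \<noteq> w"
  shows False
proof -
  have diff: "(1 + x$1) * (a + b) = 2 * x$2"
    if "tangent_val a x = 0" "tangent_val b x = 0" "a \<noteq> b" for a b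
  proof -
    have "(a - b) * ((1 + x$1) * (a + b) - 2 * x$2) = 0"
      using that(1,2) by (simp add: tangent_val_def algebra_simps power2_eq_square)
    then show ?thesis using that(3) by simp
  qed
  have "(1 + x$1) * (v - w) = 0"
    using diff[OF assms(1,2,4)] diff[OF assms(1,3,5)] by (simp add: algebra_simps)
  then have "1 + x$1 = 0" using assms(6) by simp
  moreover from this have "x$2 = 0" using diff[OF assms(1,2,4)] by simp
  ultimately show False using assms(1) by (simp add: tangent_val_def)
qed

text \<open>The two roots of \<open>\<lambda>v. tangent_val v x\<close> determine its coefficients up to a factor, and the factor
  is determined because the first and last coefficient add up to \<open>2\<close>.\<close>

lemma two_tangents_meet_once:
  assumes "u \<noteq> v" "tangent_val u x = 0" "tangent_val v x = 0" "tangent_val u y = 0" "tangent_val v y = 0"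
  shows "x = y"
proof -
  have sum: "(1 + z$1) * (u + v) = 2 * z$2" and prod: "(1 + z$1) * (u * v) = 1 - z$1"
    if "tangent_val u z = 0" "tangent_val v z = 0" for z
  proof -
    have "(u - v) * ((1 + z$1) * (u + v) - 2 * z$2) = 0"
      using that by (simp add: tangent_val_def algebra_simps power2_eq_square)
    then show *: "(1 + z$1) * (u + v) = 2 * z$2" using assms(1) by simp
    have "(1 + z$1) * u\<^sup>2 - ((1 + z$1) * (u + v)) * u + (1 - z$1) = 0"
      using that(1) unfolding * by (simp add: tangent_val_def)
    then show "(1 + z$1) * (u * v) = 1 - z$1" by (simp add: algebra_simps power2_eq_square)
  qed
  have a: "(1 + x$1) * (1 + u * v) = 2" "(1 + y$1) * (1 + u * v) = 2"
    using prod[OF assms(2,3)] prod[OF assms(4,5)] by (simp_all add: algebra_simps)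
  then have "1 + u * v \<noteq> 0" by auto
  then have 1: "x$1 = y$1" using a by (metis add_left_cancel mult_right_cancel)
  then have "x$2 = y$2" using sum[OF assms(2,3)] sum[OF assms(4,5)] by simp
  with 1 show ?thesis by (simp add: vec_eq_iff forall_2)
qed

lemma circumscribed_eq_Inter:
  "circumscribed T = \<Inter>((\<lambda>v. {x. outer_normal v \<bullet> x \<le> 1 + v\<^sup>2}) ` T)"
  by (auto simp: circumscribed_def tangent_val_eq)

lemma polyhedron_circumscribed: "finite T \<Longrightarrow> polyhedron (circumscribed T)"
  unfolding circumscribed_eq_Inter
  by (rule polyhedron_Inter) (auto simp: polyhedron_halfspace_le)

lemma interior_circumscribed:
  assumes "finite T"
  shows "interior (circumscribed T) = {x. \<forall>v\<in>T. 0 < tangent_val v x}"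
proof -
  have "interior (circumscribed T) = (\<Inter>v\<in>T. interior {x. outer_normal v \<bullet> x \<le> 1 + v\<^sup>2})"
    using assms unfolding circumscribed_eq_Inter by (induction T) auto
  also have "\<dots> = (\<Inter>v\<in>T. {x. outer_normal v \<bullet> x < 1 + v\<^sup>2})"
    by (simp add: outer_normal_neq_0)
  finally show ?thesis by (auto simp: tangent_val_eq)
qed

lemma closed_circumscribed: "finite T \<Longrightarrow> closed (circumscribed T)"
  using polyhedron_circumscribed polyhedron_imp_closed by blast

lemma frontier_circumscribed:
  assumes "finite T"
  shows "frontier (circumscribed T) =
    {x. (\<forall>v\<in>T. 0 \<le> tangent_val v x) \<and> (\<exists>v\<in>T. tangent_val v x = 0)}"
  unfolding frontier_def closure_closed[OF closed_circumscribed[OF assms]] interior_circumscribed[OF assms]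
  by (force simp: circumscribed_def)

lemma interior_circumscribed_nonempty:
  assumes "finite T"
  shows "interior (circumscribed T) \<noteq> {}"
proof -
  have "0 \<in> interior (circumscribed T)"
    unfolding interior_circumscribed[OF assms]
    using one_plus_square_pos by (simp add: tangent_val_eq)
  then show ?thesis by blast
qed

text \<open>No constraint is redundant: a point slightly beyond the point of contact of one side violates
  the constraint of this side and no other.\<close>

lemma card_edges_circumscribed:
  assumes "finite T"
  shows "card {E. E edge_of circumscribed T} = card T" and "aff_dim (circumscribed T) = 2"
proof -
  let ?P = "circumscribed T"
  define h where "h v = {x. outer_normal v \<bullet> x \<le> 1 + v\<^sup>2}" for v
  define e where "e v = ?P \<inter> {x. outer_normal v \<bullet> x = 1 + v\<^sup>2}" for v
  have touch_h: "outer_normal v \<bullet> touch v = 1 + v\<^sup>2" for v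
    using tangent_val_touch[of v v] by (simp add: tangent_val_eq)
  have touch_le: "outer_normal v \<bullet> touch w < 1 + v\<^sup>2" if "v \<noteq> w" for v w
    using tangent_val_touch_pos[OF that] by (simp add: tangent_val_eq)
  have hull: "affine hull ?P = UNIV"
    using interior_circumscribed_nonempty[OF assms] by (rule affine_hull_nonempty_interior)
  then show dim: "aff_dim ?P = 2"
    using aff_dim_eq_full[of ?P] by simp
  have beyond: "\<exists>y. y \<notin> h v \<and> (\<forall>w\<in>T-{v}. y \<in> h w)" for v
  proof -
    define U where "U = (\<Inter>w\<in>T-{v}. {x. outer_normal w \<bullet> x < 1 + w\<^sup>2})"
    have "open U" unfolding U_def using assms by (intro open_INT) (auto simp: open_halfspace_lt)
    moreover have "touch v \<in> U" using touch_le by (simp add: U_def)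
    ultimately obtain \<delta> where \<delta>: "\<delta> > 0" "ball (touch v) \<delta> \<subseteq> U"
      by (rule openE)
    define y where "y = touch v + (\<delta> / 2 / norm (outer_normal v)) *\<^sub>R outer_normal v"
    have "y \<in> ball (touch v) \<delta>"
      using \<delta>(1) by (simp add: y_def dist_norm outer_normal_neq_0)
    then have "y \<in> U" using \<delta>(2) by blast
    then have "\<forall>w\<in>T-{v}. y \<in> h w" by (auto simp: U_def h_def intro: less_imp_le)
    moreover have "0 < \<delta> / 2 / norm (outer_normal v) * (outer_normal v \<bullet> outer_normal v)"
      using \<delta>(1) by (intro mult_pos_pos divide_pos_pos) (simp_all add: outer_normal_neq_0)
    then have "y \<notin> h v"
      by (simp add: y_def h_def inner_add_right touch_h)
    ultimately show ?thesis by blast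
  qed
  have inj_h: "inj_on h T"
  proof (rule inj_onI)
    fix v w assume "v \<in> T" "w \<in> T" "h v = h w"
    then show "v = w" using beyond[of v] by blast
  qed
  define g where "g = inv_into T h"
  have g: "g (h v) = v" if "v \<in> T" for v
    using inj_h that by (simp add: g_def)
  have "E facet_of ?P \<longleftrightarrow>
      (\<exists>H. H \<in> h ` T \<and> E = ?P \<inter> {x. outer_normal (g H) \<bullet> x = 1 + (g H)\<^sup>2})" for E
  proof (rule facet_of_polyhedron_explicit)
    show "finite (h ` T)" using assms by simp
    show "?P = affine hull ?P \<inter> \<Inter>(h ` T)"
      unfolding hull by (simp add: circumscribed_eq_Inter h_def)
    show "outer_normal (g H) \<noteq> 0 \<and> H = {x. outer_normal (g H) \<bullet> x \<le> 1 + (g H)\<^sup>2}"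
      if "H \<in> h ` T" for H
      using that g by (auto simp: outer_normal_neq_0 h_def)
    show "?P \<subset> affine hull ?P \<inter> \<Inter>F'" if F': "F' \<subset> h ` T" for F'
    proof -
      obtain v where v: "v \<in> T" "h v \<notin> F'" using F' by blast
      obtain y where y: "y \<notin> h v" "\<forall>w\<in>T-{v}. y \<in> h w" using beyond by blast
      have P: "?P = \<Inter>(h ` T)" by (simp add: circumscribed_eq_Inter h_def)
      have "y \<in> \<Inter>F'" using F' v y by blast
      moreover have "y \<notin> ?P" using y(1) v(1) unfolding P by blast
      moreover have "?P \<subseteq> \<Inter>F'" unfolding P using F' by blast
      ultimately show ?thesis unfolding hull by blast
    qed
  qed
  then have "{E. E facet_of ?P} = e ` T"
    using g by (auto simp: e_def)
  moreover have "{E. E facet_of ?P} = {E. E edge_of ?P}"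
    using dim by (auto simp: facet_of_def edge_of_def)
  moreover have "inj_on e T"
  proof (rule inj_onI)
    fix v w assume vw: "v \<in> T" "w \<in> T" "e v = e w"
    have "touch v \<in> ?P"
      using one_plus_square_pos[of v] by (simp add: circumscribed_def tangent_val_touch)
    then have "touch v \<in> e w" using touch_h vw(3) unfolding e_def by blast
    then show "v = w" using touch_le[of w v] by (auto simp: e_def)
  qed
  ultimately show "card {E. E edge_of ?P} = card T"
    by (simp add: card_image)
qed

lemma convex_ngon_circumscribed:
  assumes "finite T" "bounded (circumscribed T)"
  shows "convex_ngon (card T) (frontier (circumscribed T))"
  unfolding convex_ngon_def polytope_eq_bounded_polyhedron
  using card_edges_circumscribed[OF assms(1)] polyhedron_circumscribed[OF assms(1)] assms(2)
  by (intro exI[of _ "circumscribed T"]) simp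

section \<open>Polygons with interlacing points of contact\<close>

text \<open>Suitable positive combinations of two constraints eliminate the second coordinate. Here the
  parameters \<open>e - 2\<close> and \<open>e + 2\<close> bound the first coordinate from below, \<open>e - 2\<close> and \<open>e\<close> bound
  it from above, and then \<open>e - 2\<close> and \<open>e + 2\<close> bound the second one.\<close>

lemma bounded_circumscribed:
  assumes e: "0 < e" "e < 1" and T: "e - 2 \<in> T" "e \<in> T" "e + 2 \<in> T"
  shows "bounded (circumscribed T)"
proof -
  have elim: "(1 + x$1) * (1 + a * b) \<le> 2"
    if "x \<in> circumscribed T" "a \<in> T" "b \<in> T" "a < 0" "0 < b" for x a b
  proof -
    have "0 \<le> b * tangent_val a x - a * tangent_val b x"
    proof -
      have "0 \<le> b * tangent_val a x" "a * tangent_val b x \<le> 0"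
        using that by (auto simp: circumscribed_def intro: mult_nonneg_nonneg mult_nonpos_nonneg)
      then show ?thesis by simp
    qed
    also have "\<dots> = (b - a) * (2 - (1 + x$1) * (1 + a * b))"
      by (simp add: tangent_val_def algebra_simps power2_eq_square)
    finally show ?thesis using that by (simp add: zero_le_mult_iff)
  qed
  define H where "H = 2 / (1 - e)\<^sup>2 + 2 / (3 - e\<^sup>2)"
  define K where "K = H * 8 + 2"
  have e2: "e\<^sup>2 < 1" using e by (simp add: power_less_one_iff abs_square_less_1)
  have "norm x \<le> 1 + H + K" if x: "x \<in> circumscribed T" for x
  proof -
    let ?X = "1 + x$1"
    have "?X * (1 - e)\<^sup>2 \<le> 2"
      using elim[OF x T(1,2)] e by (simp add: algebra_simps power2_eq_square)
    then have up: "?X \<le> 2 / (1 - e)\<^sup>2" using e by (simp add: pos_le_divide_eq)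
    have "- ?X * (3 - e\<^sup>2) \<le> 2"
      using elim[OF x T(1,3)] e by (simp add: algebra_simps power2_eq_square)
    then have lo: "- ?X \<le> 2 / (3 - e\<^sup>2)" using e2 by (simp add: pos_le_divide_eq)
    have "0 \<le> 2 / (1 - e)\<^sup>2" "0 \<le> 2 / (3 - e\<^sup>2)" using e2 by auto
    then have X: "\<bar>?X\<bar> \<le> H" using up lo unfolding H_def by linarith
    have tv: "2 * x$2 * v \<le> K" if "v \<in> T" "v\<^sup>2 \<le> 9" for v
    proof -
      have "2 * x$2 * v \<le> ?X * (v\<^sup>2 - 1) + 2"
        using x that(1) by (auto simp: circumscribed_def tangent_val_def algebra_simps)
      also have "?X * (v\<^sup>2 - 1) \<le> \<bar>?X\<bar> * \<bar>v\<^sup>2 - 1\<bar>"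
        by (simp flip: abs_mult)
      also have "\<bar>?X\<bar> * \<bar>v\<^sup>2 - 1\<bar> \<le> H * 8"
        using X that(2) zero_le_power2[of v] by (intro mult_mono) linarith+
      finally show ?thesis by (simp add: K_def)
    qed
    have "(e - 2)\<^sup>2 \<le> 2\<^sup>2" "(e + 2)\<^sup>2 \<le> 3\<^sup>2"
      using e by (intro power2_le_iff_abs_le[THEN iffD2]; simp)+
    then have y: "2 * x$2 * (e - 2) \<le> K" "2 * x$2 * (e + 2) \<le> K"
      using tv[OF T(1)] tv[OF T(3)] by simp_all
    have "0 \<le> K" using X by (simp add: K_def)
    have "\<bar>x$2\<bar> \<le> K"
    proof (cases "0 \<le> x$2")
      case True
      then have "x$2 * 1 \<le> x$2 * (2 * (e + 2))" using e by (intro mult_left_mono) auto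
      then show ?thesis using y(2) True by (simp add: algebra_simps)
    next
      case False
      then have "(- x$2) * 1 \<le> (- x$2) * (2 * (2 - e))" using e by (intro mult_left_mono) auto
      also have "(- x$2) * (2 * (2 - e)) = 2 * x$2 * (e - 2)" by (simp add: algebra_simps)
      finally show ?thesis using y(1) False by simp
    qed
    moreover have "\<bar>x$1\<bar> \<le> 1 + H" using X by linarith
    moreover have "norm x \<le> \<bar>x$1\<bar> + \<bar>x$2\<bar>"
      using norm_le_l1_cart[of x] by (simp add: sum_2)
    ultimately show ?thesis by linarith
  qed
  then show ?thesis unfolding bounded_iff by blast
qed

text \<open>The parameters of the points of contact of an \<open>N\<close>-gon. Different shifts \<open>e\<close> from the open unit
  interval give disjoint sets, and these interlace because the step is larger than any shift. The
  parameters are ordered cyclically, the last one being followed by the first one across the point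
  at infinity. The arc between these two has to be shorter than a half circle, that is, their
  product has to be below \<open>-1\<close>; the offset \<open>-2\<close> ensures this from three sides on.\<close>

definition grid :: "nat \<Rightarrow> real \<Rightarrow> real set" where
  "grid N e = (\<lambda>j. 2 * real j - 2 + e) ` {..<N}"

lemma card_grid: "card (grid N e) = N"
  unfolding grid_def by (subst card_image) (auto simp: inj_on_def)

lemma finite_grid: "finite (grid N e)"
  by (simp add: grid_def)

lemma grid_disjoint:
  assumes "0 < e" "e < 1" "0 < e'" "e' < 1" "e \<noteq> e'"
  shows "grid N e \<inter> grid M e' = {}"
proof -
  have False if "2 * real a - 2 + e = 2 * real b - 2 + e'" for a b
  proof -
    have "\<bar>real a - real b\<bar> < 1" using that assms by linarith
    then have "a = b" by linarith
    then show False using that assms(5) by simp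
  qed
  then show ?thesis unfolding grid_def by blast
qed

text \<open>By \<open>tangent_val_meet\<close> the expression \<open>(v - s) * (v - t) * (1 + s * t)\<close> has the sign of
  \<open>tangent_val v\<close> at the common point of the tangents at \<open>s\<close> and \<open>t\<close>. So the second conclusion makes this
  point a vertex of the \<open>N\<close>-gon, the third one puts it outside the \<open>M\<close>-gon, and the first one says in which
  direction from the point of contact \<open>s\<close> it lies.\<close>

lemma grid_successor:
  fixes j N M :: nat and e e' :: real
  assumes N: "3 \<le> N" "N \<le> M" and e: "0 < e" "e < 1" "0 < e'" "e' < 1" "e \<noteq> e'" and j: "j < N"
  defines "g \<equiv> \<lambda>j. 2 * real j - 2 + e"
  defines "s \<equiv> g j" and "t \<equiv> g (Suc j mod N)"
  shows "0 < (t - s) * (1 + s * t)"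
    and "\<And>v. v \<in> grid N e \<Longrightarrow> 0 \<le> (v - s) * (v - t) * (1 + s * t)"
    and "\<exists>v\<in>grid M e'. (v - s) * (v - t) * (1 + s * t) < 0"
proof -
  have gridM: "2 * real i - 2 + e' \<in> grid M e'" if "i < M" for i
    using that by (auto simp: grid_def)
  have "0 < (t - s) * (1 + s * t) \<and> (\<forall>v\<in>grid N e. 0 \<le> (v - s) * (v - t) * (1 + s * t)) \<and>
    (\<exists>v\<in>grid M e'. (v - s) * (v - t) * (1 + s * t) < 0)"
  proof (cases "Suc j < N")
    case True
    \<comment> \<open>Neighbours at distance \<open>2\<close>: here \<open>1 + s * t\<close> is a square, and \<open>s = -1\<close> is impossible as \<open>e\<close> is
      not an integer.\<close>
    then have t: "t = s + 2" by (simp add: t_def s_def g_def)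
    have "s + 1 \<noteq> 0"
      using e by (cases j) (auto simp: s_def g_def)
    moreover have st: "1 + s * t = (s + 1)\<^sup>2" unfolding t by (simp add: algebra_simps power2_eq_square)
    ultimately have pos: "0 < 1 + s * t" by simp
    have "0 \<le> (v - s) * (v - t)" if v: "v \<in> grid N e" for v
    proof -
      obtain i where i: "v = g i" using v by (auto simp: grid_def g_def)
      show ?thesis
      proof (cases "i \<le> j")
        case True
        then have "v \<le> s" by (simp add: i s_def g_def)
        then show ?thesis unfolding t by (intro mult_nonpos_nonpos) auto
      next
        case False
        then have "real (Suc j) \<le> real i" by (subst of_nat_le_iff) simp
        then have "t \<le> v" unfolding t by (simp add: i s_def g_def)
        then show ?thesis unfolding t by (intro mult_nonneg_nonneg) auto
      qed
    qed
    moreover have "\<exists>v\<in>grid M e'. (v - s) * (v - t) < 0"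
    proof (cases "e < e'")
      case True
      have "(2 * real j - 2 + e' - s) * (2 * real j - 2 + e' - t) < 0"
        using True e unfolding t by (intro mult_pos_neg) (auto simp: s_def g_def)
      then show ?thesis using gridM[of j] j N by auto
    next
      case False
      have "(2 * real (Suc j) - 2 + e' - s) * (2 * real (Suc j) - 2 + e' - t) < 0"
        using False e unfolding t by (intro mult_pos_neg) (auto simp: s_def g_def)
      then show ?thesis using gridM[of "Suc j"] \<open>Suc j < N\<close> N by (meson less_le_trans)
    qed
    ultimately show ?thesis
      using pos by (auto simp: t mult_less_0_iff)
  next
    case False
    \<comment> \<open>The last parameter and the first one, where \<open>1 + s * t\<close> is negative.\<close>
    then have "Suc j = N" using j by simp
    then have t: "t = e - 2" and s: "s = 2 * real N - 4 + e"
      by (auto simp: t_def s_def g_def)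
    have "s \<ge> e + 2" using N unfolding s by simp
    then have "s * t \<le> (e + 2) * t"
      using e unfolding t by (intro mult_right_mono_neg) auto
    also have "\<dots> = e * e - 4" unfolding t by (simp add: algebra_simps)
    also have "e * e < 1 * 1" using e by (intro mult_strict_mono) auto
    finally have neg: "1 + s * t < 0" by simp
    have "(v - s) * (v - t) \<le> 0" if v: "v \<in> grid N e" for v
    proof -
      obtain i where i: "i < N" "v = g i" using v by (auto simp: grid_def g_def)
      have "real i \<le> real N - 1" using i(1) by linarith
      then have "v \<le> s" "t \<le> v" unfolding i(2) s t g_def by auto
      then show ?thesis by (intro mult_nonpos_nonneg) auto
    qed
    moreover have "\<exists>v\<in>grid M e'. (v - s) * (v - t) > 0"
    proof (cases "e < e'")
      case True
      have "(2 * real j - 2 + e' - s) * (2 * real j - 2 + e' - t) > 0"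
        using True e \<open>s \<ge> e + 2\<close> unfolding t s_def g_def by (intro mult_pos_pos) auto
      then show ?thesis using gridM[of j] j N by auto
    next
      case False
      have "(2 * real 0 - 2 + e' - s) * (2 * real 0 - 2 + e' - t) > 0"
        using False e \<open>s \<ge> e + 2\<close> unfolding t by (intro mult_neg_neg) auto
      then show ?thesis using gridM[of 0] N by auto
    qed
    moreover have "t < s" using \<open>s \<ge> e + 2\<close> unfolding t by simp
    ultimately show ?thesis
      using neg by (auto simp: zero_le_mult_iff mult_less_0_iff zero_less_mult_iff)
  qed
  then show "0 < (t - s) * (1 + s * t)"
    and "\<And>v. v \<in> grid N e \<Longrightarrow> 0 \<le> (v - s) * (v - t) * (1 + s * t)"
    and "\<exists>v\<in>grid M e'. (v - s) * (v - t) * (1 + s * t) < 0" by blast+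
qed

text \<open>Both ends of the side touching at \<open>s\<close>: for \<open>\<delta> = 1\<close> the neighbour is the successor of \<open>s\<close>, for
  \<open>\<delta> = -1\<close> it is the predecessor, whose successor is \<open>s\<close>.\<close>

lemma grid_neighbour:
  assumes N: "3 \<le> N" "N \<le> M" and e: "0 < e" "e < 1" "0 < e'" "e' < 1" "e \<noteq> e'"
    and s: "s \<in> grid N e" and \<delta>: "\<delta> = 1 \<or> \<delta> = -1"
  obtains t where "0 < \<delta> * ((t - s) * (1 + s * t))"
    "\<And>v. v \<in> grid N e \<Longrightarrow> 0 \<le> (v - s) * (v - t) * (1 + s * t)"
    "\<exists>v\<in>grid M e'. (v - s) * (v - t) * (1 + s * t) < 0"
proof -
  define g where "g j = 2 * real j - 2 + e" for j
  obtain j where j: "j < N" "s = g j" using s by (auto simp: grid_def g_def)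
  note succ = grid_successor[OF N e, folded g_def]
  show thesis
  proof (cases "\<delta> = 1")
    case True
    then show ?thesis using that[of "g (Suc j mod N)"] succ[OF j(1), folded j(2)] by simp
  next
    case False
    define i where "i = (if j = 0 then N - 1 else j - 1)"
    have i: "i < N" "Suc i mod N = j" using j(1) by (auto simp: i_def)
    have sym: "(v - s) * (v - g i) * (1 + s * g i) = (v - g i) * (v - s) * (1 + g i * s)" for v
      by (simp add: mult_ac)
    have "\<delta> * ((g i - s) * (1 + s * g i)) = (s - g i) * (1 + g i * s)"
      using False \<delta> by (auto simp: algebra_simps)
    then show ?thesis
      using that[of "g i"] succ[OF i(1), unfolded i(2), folded j(2)] unfolding sym by simp
  qed
qed

text \<open>The point of contact of a side of the \<open>N\<close>-gon is interior to the \<open>M\<close>-gon and the vertex at either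
  end is outside, so each half of the side crosses the boundary of the \<open>M\<close>-gon.\<close>

lemma circumscribed_grids_meet_on_half_side:
  assumes N: "3 \<le> N" "N \<le> M" and e: "0 < e" "e < 1" "0 < e'" "e' < 1" "e \<noteq> e'"
    and s: "s \<in> grid N e" and \<delta>: "\<delta> = 1 \<or> \<delta> = -1"
  obtains l where "0 < \<delta> * l"
    "touch s + l *\<^sub>R tangent_dir s \<in> frontier (circumscribed (grid M e'))"
    "\<And>v. v \<in> grid N e - {s} \<Longrightarrow> 0 < tangent_val v (touch s + l *\<^sub>R tangent_dir s)"
proof -
  let ?T = "grid N e" and ?S = "grid M e'"
  have "s \<notin> ?S" using grid_disjoint[OF e, of N M] s by blast
  obtain t where t: "0 < \<delta> * ((t - s) * (1 + s * t))"
    "\<And>v. v \<in> ?T \<Longrightarrow> 0 \<le> (v - s) * (v - t) * (1 + s * t)"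
    "\<exists>v\<in>?S. (v - s) * (v - t) * (1 + s * t) < 0"
    using grid_neighbour[OF N e s \<delta>] by blast
  have st: "1 + s * t \<noteq> 0" using t(1) by auto
  define l0 where "l0 = (t - s) * (1 + s * t) / ((1 + s\<^sup>2) * (1 + s * t)\<^sup>2)"
  define w where "w = touch s + l0 *\<^sub>R tangent_dir s"
  have w: "tangent_val v w = 2 * ((v - s) * (v - t) * (1 + s * t)) / (1 + s * t)\<^sup>2" for v
    unfolding w_def by (rule tangent_val_meet[OF st l0_def])
  have l0: "0 < \<delta> * l0"
  proof -
    have "\<delta> * l0 = \<delta> * ((t - s) * (1 + s * t)) / ((1 + s\<^sup>2) * (1 + s * t)\<^sup>2)"
      by (simp add: l0_def)
    then show ?thesis using t(1) st one_plus_square_pos[of s] by simp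
  qed
  have u: "touch s \<in> interior (circumscribed ?S)"
    unfolding interior_circumscribed[OF finite_grid]
    using \<open>s \<notin> ?S\<close> by (auto intro!: tangent_val_touch_pos)
  have wS: "w \<notin> circumscribed ?S"
  proof -
    obtain v where "v \<in> ?S" "(v - s) * (v - t) * (1 + s * t) < 0" using t(3) by blast
    moreover from this have "tangent_val v w < 0"
      unfolding w using st by (intro divide_neg_pos) auto
    ultimately show ?thesis by (force simp: circumscribed_def)
  qed
  have "closed_segment (touch s) w \<inter> frontier (circumscribed ?S) \<noteq> {}"
    using u wS interior_subset[of "circumscribed ?S"] by (intro connected_Int_frontier) auto
  then obtain \<tau> where \<tau>: "0 \<le> \<tau>" "\<tau> \<le> 1"
    "(1 - \<tau>) *\<^sub>R touch s + \<tau> *\<^sub>R w \<in> frontier (circumscribed ?S)"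
    by (auto simp: closed_segment_def)
  have "\<tau> \<noteq> 0" using \<tau>(3) u by (auto simp: frontier_def)
  have "\<tau> \<noteq> 1"
    using \<tau>(3) wS frontier_subset_closed[OF closed_circumscribed[OF finite_grid]] by fastforce
  have eq: "(1 - \<tau>) *\<^sub>R touch s + \<tau> *\<^sub>R w = touch s + (\<tau> * l0) *\<^sub>R tangent_dir s"
    by (simp add: w_def algebra_simps)
  show thesis
  proof (rule that[of "\<tau> * l0"])
    have "0 < \<tau> * (\<delta> * l0)" using l0 \<tau>(1) \<open>\<tau> \<noteq> 0\<close> by (simp add: zero_less_mult_iff)
    then show "0 < \<delta> * (\<tau> * l0)" by (simp add: mult_ac)
    show "touch s + (\<tau> * l0) *\<^sub>R tangent_dir s \<in> frontier (circumscribed ?S)"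
      using \<tau>(3) unfolding eq .
    fix v assume v: "v \<in> ?T - {s}"
    have "0 \<le> tangent_val v w" unfolding w using t(2)[of v] v by simp
    then show "0 < tangent_val v (touch s + (\<tau> * l0) *\<^sub>R tangent_dir s)"
      unfolding eq[symmetric] tangent_val_convex using \<tau>(1,2) \<open>\<tau> \<noteq> 1\<close> v
      by (intro add_pos_nonneg mult_pos_pos mult_nonneg_nonneg tangent_val_touch_pos) auto
  qed
qed

definition grid_polygon :: "nat \<Rightarrow> real \<Rightarrow> (real^2) set" where
  "grid_polygon N e = frontier (circumscribed (grid N e))"

lemma convex_ngon_grid_polygon:
  assumes "3 \<le> N" "0 < e" "e < 1"
  shows "convex_ngon N (grid_polygon N e)"
proof -
  have "2 * real j - 2 + e \<in> grid N e" if "j < N" for j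
    using that by (auto simp: grid_def)
  from this[of 0] this[of 1] this[of 2] have "e - 2 \<in> grid N e" "e \<in> grid N e" "e + 2 \<in> grid N e"
    using assms(1) by (simp_all add: algebra_simps)
  then have "bounded (circumscribed (grid N e))"
    using bounded_circumscribed assms(2,3) by blast
  then show ?thesis
    using convex_ngon_circumscribed[OF finite_grid] unfolding grid_polygon_def by (metis card_grid)
qed

lemma grid_polygon_tangent:
  assumes "x \<in> grid_polygon N e"
  obtains v where "v \<in> grid N e" "tangent_val v x = 0"
  using assms unfolding grid_polygon_def frontier_circumscribed[OF finite_grid] by blast

lemma finite_Int_grid_polygons:
  assumes "0 < e" "e < 1" "0 < e'" "e' < 1" "e \<noteq> e'"
  shows "finite (grid_polygon N e \<inter> grid_polygon M e')"
proof (rule finite_subset)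
  show "grid_polygon N e \<inter> grid_polygon M e' \<subseteq>
      (\<Union>u\<in>grid N e. \<Union>v\<in>grid M e'. {x. tangent_val u x = 0 \<and> tangent_val v x = 0})"
    by (auto elim!: grid_polygon_tangent)
  have "finite {x. tangent_val u x = 0 \<and> tangent_val v x = 0}"
    if "u \<in> grid N e" "v \<in> grid M e'" for u v
  proof -
    have "u \<noteq> v" using grid_disjoint[OF assms, of N M] that by blast
    then have "\<exists>y. {x. tangent_val u x = 0 \<and> tangent_val v x = 0} \<subseteq> {y}"
      using two_tangents_meet_once[of u v] by blast
    then show ?thesis using finite_subset by blast
  qed
  then show "finite (\<Union>u\<in>grid N e. \<Union>v\<in>grid M e'. {x. tangent_val u x = 0 \<and> tangent_val v x = 0})"
    by (intro finite_UN_I finite_grid)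
qed

text \<open>The crossings on the \<open>2 * N\<close> half-sides are distinct: a crossing lies on no side but its own, and
  the two halves of a side lie in opposite directions from the point of contact.\<close>

lemma card_Int_grid_polygons_ge:
  assumes N: "3 \<le> N" "N \<le> M" and e: "0 < e" "e < 1" "0 < e'" "e' < 1" "e \<noteq> e'"
  shows "2 * N \<le> card (grid_polygon N e \<inter> grid_polygon M e')"
proof -
  let ?T = "grid N e"
  define on where "on s \<delta> x \<longleftrightarrow> (\<exists>l. 0 < \<delta> * l \<and> x = touch s + l *\<^sub>R tangent_dir s) \<and>
    x \<in> frontier (circumscribed (grid M e')) \<and> (\<forall>v\<in>?T-{s}. 0 < tangent_val v x)"
    for s \<delta> :: real and x
  have ex: "\<forall>p\<in>?T \<times> {1,-1}. \<exists>x. on (fst p) (snd p) x"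
  proof
    fix p assume "p \<in> ?T \<times> {1::real,-1}"
    then have "fst p \<in> ?T" "snd p = 1 \<or> snd p = -1" by auto
    from circumscribed_grids_meet_on_half_side[OF N e this]
    show "\<exists>x. on (fst p) (snd p) x" unfolding on_def by metis
  qed
  then obtain f where f: "\<And>p. p \<in> ?T \<times> {1,-1} \<Longrightarrow> on (fst p) (snd p) (f p)"
    unfolding bchoice_iff by blast
  have on0: "tangent_val s x = 0" if "on s \<delta> x" for s \<delta> x
    using that tangent_val_tangent_line[of s s] by (auto simp: on_def)
  have "inj_on f (?T \<times> {1,-1})"
  proof (rule inj_onI)
    fix p q assume pq: "p \<in> ?T \<times> {1,-1}" "q \<in> ?T \<times> {1,-1}" "f p = f q"
    have "fst p = fst q"
    proof (rule ccontr)
      assume "fst p \<noteq> fst q"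
      then have "0 < tangent_val (fst p) (f q)"
        using f[OF pq(2)] pq(1) unfolding on_def by auto
      then show False using on0[OF f[OF pq(1)]] pq(3) by simp
    qed
    moreover have "snd p = snd q"
    proof -
      obtain l where l: "0 < snd p * l" "f p = touch (fst p) + l *\<^sub>R tangent_dir (fst p)"
        using f[OF pq(1)] unfolding on_def by blast
      obtain l' where l': "0 < snd q * l'" "f q = touch (fst q) + l' *\<^sub>R tangent_dir (fst q)"
        using f[OF pq(2)] unfolding on_def by blast
      have "l = l'" using l(2) l'(2) pq(3) \<open>fst p = fst q\<close> tangent_dir_neq_0 by simp
      then show ?thesis using l(1) l'(1) pq(1,2) by (auto simp: mem_Times_iff)
    qed
    ultimately show "p = q" by (simp add: prod_eq_iff)
  qed
  then have "card (f ` (?T \<times> {1,-1})) = 2 * N"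
    by (simp add: card_image card_cartesian_product card_grid)
  moreover have "f ` (?T \<times> {1,-1}) \<subseteq> grid_polygon N e \<inter> grid_polygon M e'"
  proof
    fix x assume "x \<in> f ` (?T \<times> {1,-1})"
    then obtain p where p: "p \<in> ?T \<times> {1,-1}" "x = f p" by blast
    have on: "on (fst p) (snd p) x" using f[OF p(1)] p(2) by simp
    have "fst p \<in> ?T" using p(1) by auto
    have "0 \<le> tangent_val v x" if "v \<in> ?T" for v
      using on0[OF on] on that unfolding on_def by (cases "v = fst p") (auto intro: less_imp_le)
    then have "x \<in> grid_polygon N e"
      using on0[OF on] \<open>fst p \<in> ?T\<close> unfolding grid_polygon_def frontier_circumscribed[OF finite_grid] by blast
    moreover have "x \<in> grid_polygon M e'" using on unfolding on_def grid_polygon_def by blast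
    ultimately show "x \<in> grid_polygon N e \<inter> grid_polygon M e'" by blast
  qed
  ultimately show ?thesis
    using finite_Int_grid_polygons[OF e] card_mono by metis
qed

lemma touch_mem_grid_polygon:
  assumes "s \<in> grid N e"
  shows "touch s \<in> grid_polygon N e"
  unfolding grid_polygon_def frontier_circumscribed[OF finite_grid]
  using one_plus_square_pos[of s] assms by (auto simp: tangent_val_touch intro!: bexI[of _ s])

lemma grid_polygon_neq:
  assumes "1 \<le> N" "0 < e" "e < 1" "0 < e'" "e' < 1" "e \<noteq> e'"
  shows "grid_polygon N e \<noteq> grid_polygon M e'"
proof
  assume eq: "grid_polygon N e = grid_polygon M e'"
  define s where "s = e - 2"
  have s: "s \<in> grid N e" using assms(1) by (force simp: grid_def s_def)
  then have "touch s \<in> grid_polygon N e" by (rule touch_mem_grid_polygon)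
  then obtain v where "v \<in> grid M e'" "tangent_val v (touch s) = 0"
    unfolding eq by (rule grid_polygon_tangent)
  moreover from this have "v \<noteq> s" using grid_disjoint[OF assms(2-6), of N M] s by blast
  ultimately show False using tangent_val_touch_pos[of v s] by simp
qed

section \<open>The maximal configuration\<close>

lemma connected_Union_pairwise:
  assumes "\<And>C. C \<in> F \<Longrightarrow> connected C" "\<And>C. C \<in> F \<Longrightarrow> C \<noteq> {}"
    "\<And>C D. C \<in> F \<Longrightarrow> D \<in> F \<Longrightarrow> C \<noteq> D \<Longrightarrow> C \<inter> D \<noteq> {}"
  shows "connected (\<Union>F)"
proof (cases "F = {}")
  case False
  then obtain C0 where C0: "C0 \<in> F" by blast
  have "connected (\<Union>((\<lambda>C. C0 \<union> C) ` F))"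
  proof (rule connected_Union)
    fix S assume "S \<in> (\<lambda>C. C0 \<union> C) ` F"
    then obtain C where "C \<in> F" "S = C0 \<union> C" by blast
    moreover from this have "C0 \<inter> C \<noteq> {}" using assms(2,3) C0 by (cases "C = C0") auto
    ultimately show "connected S" using connected_Un[OF assms(1)[OF C0] assms(1)] by simp
  next
    show "\<Inter>((\<lambda>C. C0 \<union> C) ` F) \<noteq> {}" using assms(2)[OF C0] by blast
  qed
  moreover have "\<Union>((\<lambda>C. C0 \<union> C) ` F) = \<Union>F" using C0 by blast
  ultimately show ?thesis by simp
qed simp

text \<open>Any injective choice of shifts in the open unit interval works.\<close>

lemma exists_family_with_max_nodes:
  assumes k: "1 \<le> k" and n1: "3 \<le> n 1" and n: "strict_mono_on {1..k} n"
    and m: "\<And>i. i \<in> {1..k} \<Longrightarrow> 1 \<le> m i"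
  obtains F where "F \<in> polygon_families k n m" "card (nodes F) = max_nodes k n m"
proof -
  define I where "I = (SIGMA i:{1..k}. {..<m i})"
  define eps where "eps x = 1 / (2 + real (prod_encode x))" for x :: "nat \<times> nat"
  define curve where "curve x = grid_polygon (n (fst x)) (eps x)" for x
  define F where "F = curve ` I"
  have eps: "0 < eps x" "eps x < 1" for x by (auto simp: eps_def)
  have eps_inj: "eps x \<noteq> eps y" if "x \<noteq> y" for x y
  proof
    assume "eps x = eps y"
    then have "prod_encode x = prod_encode y" by (simp add: eps_def)
    with that show False by simp
  qed
  have n3: "3 \<le> n i" if "i \<in> {1..k}" for i
    using strict_mono_on_leD[OF n, of 1 i] n1 that k by auto
  have ngon: "convex_ngon (n (fst x)) (curve x)" if "x \<in> I" for x
    unfolding curve_def using that n3 eps by (intro convex_ngon_grid_polygon) (auto simp: I_def)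
  have curve_neq: "curve x \<noteq> curve y" if "x \<in> I" "x \<noteq> y" for x y
  proof -
    have "1 \<le> n (fst x)" using n3[of "fst x"] that(1) by (auto simp: I_def)
    then show ?thesis
      unfolding curve_def using eps eps_inj[OF that(2)] by (intro grid_polygon_neq) auto
  qed
  then have inj: "inj_on curve I" by (meson inj_onI)
  have finI: "finite I" by (simp add: I_def)
  then have finF: "finite F" by (simp add: F_def)
  have fin_Int: "finite (C \<inter> D)" if CD: "C \<in> F" "D \<in> F" "C \<noteq> D" for C D
  proof -
    obtain x y where "C = curve x" "D = curve y" "x \<noteq> y" using CD by (auto simp: F_def)
    then show ?thesis using finite_Int_grid_polygons eps eps_inj by (simp add: curve_def)
  qed
  have "nodes F \<subseteq> (\<Union>C\<in>F. \<Union>D\<in>F-{C}. C \<inter> D)" unfolding nodes_def by blast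
  moreover have "finite (\<Union>C\<in>F. \<Union>D\<in>F-{C}. C \<inter> D)"
    using finF fin_Int by (intro finite_UN_I) auto
  ultimately have fin_nodes: "finite (nodes F)" by (rule finite_subset)
  have cross_le: "2 * min (sides C) (sides D) \<le> card (C \<inter> D)"
    if CD: "C \<in> F" "D \<in> F" "C \<noteq> D" and le: "sides C \<le> sides D" for C D
  proof -
    obtain x y where xy: "C = curve x" "D = curve y" "x \<noteq> y" "x \<in> I" "y \<in> I"
      using CD by (auto simp: F_def)
    have sides: "sides C = n (fst x)" "sides D = n (fst y)"
      using ngon sides_eq xy by auto
    have "2 * n (fst x) \<le> card (grid_polygon (n (fst x)) (eps x) \<inter> grid_polygon (n (fst y)) (eps y))"
      using n3[of "fst x"] le sides xy eps eps_inj
      by (intro card_Int_grid_polygons_ge) (auto simp: I_def)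
    then show ?thesis using le sides xy by (simp add: curve_def)
  qed
  have cross: "2 * min (sides C) (sides D) \<le> card (C \<inter> D)"
    if "C \<in> F" "D \<in> F" "C \<noteq> D" for C D
  proof (cases "sides C \<le> sides D")
    case False
    then show ?thesis
      using cross_le[of D C] that by (simp add: Int_commute min.commute)
  qed (use cross_le that in blast)
  have conn: "connected (\<Union>F)"
  proof (rule connected_Union_pairwise)
    show "connected C" "C \<noteq> {}" if C: "C \<in> F" for C
    proof -
      obtain x where x: "x \<in> I" "C = curve x" using C by (auto simp: F_def)
      then show "connected C" using connected_convex_ngon[OF ngon] by simp
      have "card (grid (n (fst x)) (eps x)) \<noteq> 0"
        using n3[of "fst x"] x(1) by (auto simp: card_grid I_def)
      then obtain s where "s \<in> grid (n (fst x)) (eps x)" by fastforce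
      then show "C \<noteq> {}" using touch_mem_grid_polygon x(2) unfolding curve_def by blast
    qed
    show "C \<inter> D \<noteq> {}" if CD: "C \<in> F" "D \<in> F" "C \<noteq> D" for C D
    proof -
      have "3 \<le> sides E" if E: "E \<in> F" for E
      proof -
        obtain x where x: "x \<in> I" "E = curve x" using E by (auto simp: F_def)
        then have "sides E = n (fst x)" using sides_eq[OF ngon] by simp
        then show ?thesis using n3 x(1) by (auto simp: I_def)
      qed
      from this[OF CD(1)] this[OF CD(2)] have "card (C \<inter> D) \<noteq> 0" using cross[OF CD] by auto
      then show ?thesis by auto
    qed
  qed
  have mem: "F \<in> polygon_families k n m"
  proof -
    have "\<exists>i\<in>{1..k}. convex_ngon (n i) C" if C: "C \<in> F" for C
    proof -
      obtain x where x: "x \<in> I" "C = curve x" using C by (auto simp: F_def)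
      have "fst x \<in> {1..k}" using x(1) by (auto simp: I_def)
      then show ?thesis using ngon[OF x(1)] unfolding x(2) by blast
    qed
    moreover have "card {C \<in> F. convex_ngon (n i) C} = m i" if i: "i \<in> {1..k}" for i
    proof -
      have iff: "convex_ngon (n i) (curve x) \<longleftrightarrow> fst x = i" if x: "x \<in> I" for x
      proof
        assume "convex_ngon (n i) (curve x)"
        then have "n (fst x) = n i" using convex_ngon_unique[OF ngon[OF x]] by blast
        moreover have "fst x \<in> {1..k}" using x by (auto simp: I_def)
        ultimately show "fst x = i" using inj_onD[OF strict_mono_on_imp_inj_on[OF n]] i by blast
      qed (use ngon[OF x] in simp)
      have "{C \<in> F. convex_ngon (n i) C} = curve ` {x \<in> I. fst x = i}"
        using iff unfolding F_def by blast
      also have "card \<dots> = card {x \<in> I. fst x = i}"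
        by (intro card_image inj_on_subset[OF inj]) auto
      also have "{x \<in> I. fst x = i} = {i} \<times> {..<m i}" using i by (auto simp: I_def)
      finally show ?thesis by (simp add: card_cartesian_product)
    qed
    ultimately show ?thesis
      using finF fin_nodes conn unfolding polygon_families_def by simp
  qed
  \<comment> \<open>Three curves through \<open>p\<close> would give three tangents of the unit circle through \<open>p\<close>.\<close>
  have two: "card {C \<in> F. p \<in> C} = 2" if p: "p \<in> nodes F" for p
  proof (rule antisym)
    show "2 \<le> card {C \<in> F. p \<in> C}" by (rule two_le_card_curves_through_node[OF finF p])
    show "card {C \<in> F. p \<in> C} \<le> 2"
    proof (rule ccontr)
      assume "\<not> card {C \<in> F. p \<in> C} \<le> 2"
      then have "3 \<le> card {C \<in> F. p \<in> C}" by simp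
      then obtain S where S: "S \<subseteq> {C \<in> F. p \<in> C}" "card S = 3"
        by (meson obtain_subset_with_card_n)
      then obtain A B C where ABC: "S = {A, B, C}" "A \<noteq> B" "A \<noteq> C" "B \<noteq> C"
        by (metis card_3_iff)
      have tang: "\<exists>x v. X = curve x \<and> v \<in> grid (n (fst x)) (eps x) \<and> tangent_val v p = 0"
        if X: "X \<in> S" for X
      proof -
        obtain x where x: "X = curve x" "p \<in> curve x" using X S(1) by (auto simp: F_def)
        obtain v where "v \<in> grid (n (fst x)) (eps x)" "tangent_val v p = 0"
          using x(2) unfolding curve_def by (rule grid_polygon_tangent)
        then show ?thesis using x(1) by blast
      qed
      have disj: "u \<noteq> v"
        if "u \<in> grid (n (fst x)) (eps x)" "v \<in> grid (n (fst y)) (eps y)" "curve x \<noteq> curve y" for u v x y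
        using grid_disjoint[OF eps eps eps_inj, of x y] that by blast
      obtain x u where u: "A = curve x" "u \<in> grid (n (fst x)) (eps x)" "tangent_val u p = 0"
        using tang[of A] ABC(1) by blast
      obtain y v where v: "B = curve y" "v \<in> grid (n (fst y)) (eps y)" "tangent_val v p = 0"
        using tang[of B] ABC(1) by blast
      obtain z w where w: "C = curve z" "w \<in> grid (n (fst z)) (eps z)" "tangent_val w p = 0"
        using tang[of C] ABC(1) by blast
      show False
        using no_three_tangents[OF u(3) v(3) w(3)] disj[OF u(2) v(2)] disj[OF u(2) w(2)] disj[OF v(2) w(2)]
          ABC(2-4) unfolding u(1) v(1) w(1) by simp
    qed
  qed
  have "2 * max_nodes k n m = (\<Sum>C\<in>F. \<Sum>D\<in>F-{C}. 2 * min (sides C) (sides D))"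
    by (simp flip: sum_distrib_left add: polygon_familiesD(4)[OF n mem])
  also have "\<dots> \<le> (\<Sum>C\<in>F. \<Sum>D\<in>F-{C}. card (C \<inter> D))"
    using cross by (intro sum_mono) auto
  also have "\<dots> = 2 * card (nodes F)"
    using two_card_nodes_le(2)[OF finF fin_nodes] two by simp
  finally have "max_nodes k n m \<le> card (nodes F)" by simp
  then have "card (nodes F) = max_nodes k n m"
    using card_nodes_le(1)[OF n mem] by simp
  then show thesis using that mem by blast
qed

theorem theorem3p8:
  fixes k :: nat and n :: "nat \<Rightarrow> nat"
  assumes "1 \<le> k" and "3 \<le> n 1" and "strict_mono_on {1..k} n"
  shows "(\<forall>c. maximal_configuration (polygon_families k n (\<lambda>_. 1)) c \<longleftrightarrow>
             c = replicate_mset (2 * (\<Sum>i=1..k-1. n i * (k - i))) 4)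
       \<and> (\<forall>m :: nat \<Rightarrow> nat. (\<forall>i\<in>{1..k}. 1 \<le> m i) \<longrightarrow>
            (\<forall>c. maximal_configuration (polygon_families k n m) c \<longleftrightarrow>
               c = replicate_mset
                     ((\<Sum>i=1..k. n i * m i * (m i - 1)) +
                      2 * (\<Sum>i=1..k-1. n i * m i * (\<Sum>j=i+1..k. m j))) 4))"
proof -
  have main: "maximal_configuration (polygon_families k n m) c \<longleftrightarrow> c = replicate_mset (max_nodes k n m) 4"
    if m: "\<forall>i\<in>{1..k}. 1 \<le> m i" for m c
  proof -
    obtain F where "F \<in> polygon_families k n m" "card (nodes F) = max_nodes k n m"
      using exists_family_with_max_nodes[OF assms, of m] m by blast
    then show ?thesis by (rule maximal_configuration_iff[OF assms(3)])
  qed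
  have "max_nodes k n (\<lambda>_. 1) = 2 * (\<Sum>i=1..k-1. n i * (k - i))"
    by (simp add: max_nodes_def)
  then have "\<forall>c. maximal_configuration (polygon_families k n (\<lambda>_. 1)) c \<longleftrightarrow>
      c = replicate_mset (2 * (\<Sum>i=1..k-1. n i * (k - i))) 4"
    using main[of "\<lambda>_. 1"] by simp
  moreover note main[unfolded max_nodes_def]
  ultimately show ?thesis by blast
qed

end
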